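(* Let $\{\mathcal{T}(t)\}_{t\ge 0}$ be the symmetric telegraph process with speed $c>0$ and rate $\lambda>0$, and let $t>0$. For $0<\beta<ct$, $$P\Bigl\{ \max_{0\le s\le t} \mathcal{T}(s) \in d\beta,\ N(t)\text{ even} \,\Big|\, V(0) = c\Bigr\} = \frac{\lambda t\, e^{-\lambda t}}{\sqrt{c^2t^2-\beta^2}}\, I_1\Bigl(\tfrac{\lambda}{c}\sqrt{c^2t^2-\beta^2}\Bigr)d\beta = \frac{e^{-\lambda t}}{c}\,\frac{\partial}{\partial t} I_0\Bigl(\tfrac{\lambda}{c}\sqrt{c^2t^2-\beta^2}\Bigr)d\beta ,$$ $$P\Bigl\{ \max_{0\le s\le t} \mathcal{T}(s) \in d\beta,\ N(t)\text{ odd} \,\Big|\, V(0) = c\Bigr\} = \frac{\lambda e^{-\lambda t}}{c}\, I_0\Bigl(\tfrac{\lambda}{c}\sqrt{c^2t^2-\beta^2}\Bigr)d\beta ,$$ and consequently $$P\Bigl\{ \max_{0\le s\le t} \mathcal{T}(s) \in d\beta \,\Big|\, V(0) = c\Bigr\} = \frac{e^{-\lambda t}}{c}\Bigl[\lambda I_0\Bigl(\tfrac{\lambda}{c}\sqrt{c^2t^2-\beta^2}\Bigr)+\frac{\partial}{\partial t} I_0\Bigl(\tfrac{\lambda}{c}\sqrt{c^2t^2-\beta^2}\Bigr)\Bigr]d\beta = 2P\{\mathcal{T}(t)\in d\beta\} .$$ Moreover, given $V(0)=c$, the maximum has an atom at $\beta=ct$: $P\{\max_{0\le s\le t}\mathcal{T}(s)=ct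 \mid V(0)=c\}=e^{-\lambda t}$.
   Context: Let $c>0$, $\lambda>0$. Let $V(0)$ be a random variable with $P\{V(0)=c\}=P\{V(0)=-c\}=\tfrac12$ and let $\{N(t)\}_{t\ge0}$ be a homogeneous Poisson process with rate $\lambda$, independent of $V(0)$. The symmetric telegraph process is $\mathcal{T}(t)=\int_0^t V(0)(-1)^{N(s)}\,ds$, $t\ge 0$ (so $\mathcal{T}(0)=0$). A formula $P\{X\in d\beta, E\mid A\}=f(\beta)\,d\beta$ for $0<\beta<ct$ means that the measure $B\mapsto P\{X\in B, E\mid A\}$, restricted to Borel subsets of $(0,ct)$, is absolutely continuous with density $f$; $P\{\mathcal{T}(t)\in d\beta\}$ is the unconditional law of $\mathcal{T}(t)$ (with $V(0)$ random) restricted to $(0,ct)$. $I_\nu$ is the modified Bessel function of the first kind, $I_\nu(x)=\sum_{j\ge0}\frac{(x/2)^{2j+\nu}}{j!\,\Gamma(j+\nu+1)}$. *)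

theory Defs
  imports "HOL-Probability.Probability"
begin

text \<open>
  The order is a natural number and the power is \<^const>\<open>power\<close> rather than \<^const>\<open>powr\<close>: since
  \<open>0 powr 0 = 0\<close>, the latter would give the wrong value \<open>I\<^sub>0(0) = 0\<close>.
\<close>

definition bessel_I :: "nat \<Rightarrow> real \<Rightarrow> real" where
  "bessel_I \<nu> x =
     (\<Sum>j. (x / 2) ^ (2 * j + \<nu>) / (fact j * Gamma (real j + real \<nu> + 1)))"

text \<open>
  The path properties are required for every sample point, not just almost surely, so that no
  completeness of \<open>M\<close> is needed for path functionals to be measurable.  By monotonicity, the
  truncated subtraction in the increments is the ordinary one.
\<close>

locale poisson_process = prob_space M
  for M :: "'a measure" and rate :: real and N :: "real \<Rightarrow> 'a \<Rightarrow> nat" +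
  assumes rate_pos: "0 < rate"
    and measurable_N: "\<And>t. 0 \<le> t \<Longrightarrow> N t \<in> measurable M (count_space UNIV)"
    and N_zero: "\<And>\<omega>. \<omega> \<in> space M \<Longrightarrow> N 0 \<omega> = 0"
    and N_mono: "\<And>\<omega>. \<omega> \<in> space M \<Longrightarrow> mono_on {0..} (\<lambda>t. N t \<omega>)"
    and N_right_continuous:
      "\<And>\<omega> t. \<omega> \<in> space M \<Longrightarrow> 0 \<le> t \<Longrightarrow> continuous (at_right t) (\<lambda>s. real (N s \<omega>))"
    and N_increment:
      "\<And>s t. 0 \<le> s \<Longrightarrow> s < t \<Longrightarrow>
         distr M (count_space UNIV) (\<lambda>\<omega>. N t \<omega> - N s \<omega>) = measure_pmf (poisson_pmf (rate * (t - s)))"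
    and N_indep_increments:
      "\<And>(n::nat) \<tau>. 0 \<le> \<tau> 0 \<Longrightarrow> mono \<tau> \<Longrightarrow>
         indep_vars (\<lambda>_. count_space UNIV) (\<lambda>i \<omega>. N (\<tau> (Suc i)) \<omega> - N (\<tau> i) \<omega>) {..<n}"

locale symmetric_telegraph = poisson_process M rate N
  for M :: "'a measure" and rate :: real and N :: "real \<Rightarrow> 'a \<Rightarrow> nat" +
  fixes c :: real and V0 :: "'a \<Rightarrow> real"
  assumes speed_pos: "0 < c"
    and measurable_V0: "V0 \<in> borel_measurable M"
    and V0_pos: "prob {\<omega> \<in> space M. V0 \<omega> = c} = 1 / 2"
    and V0_neg: "prob {\<omega> \<in> space M. V0 \<omega> = - c} = 1 / 2"
    and V0_indep_N:
      "indep_set {V0 -` B \<inter> space M | B. B \<in> sets borel}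
         (sigma_sets (space M) {N t -` A \<inter> space M | t A. 0 \<le> t})"

definition telegraph :: "('a \<Rightarrow> real) \<Rightarrow> (real \<Rightarrow> 'a \<Rightarrow> nat) \<Rightarrow> real \<Rightarrow> 'a \<Rightarrow> real" where
  "telegraph V0 N t \<omega> = (LINT s:{0..t}|lborel. V0 \<omega> * (- 1) ^ N s \<omega>)"

text \<open>For continuous paths, such as those of the telegraph process, the supremum is attained.\<close>

definition running_max :: "(real \<Rightarrow> 'a \<Rightarrow> real) \<Rightarrow> real \<Rightarrow> 'a \<Rightarrow> real" where
  "running_max X t \<omega> = (SUP s\<in>{0..t}. X s \<omega>)"

text \<open>
  \<open>P{X \<in> d\<beta>, E | A} = f(\<beta>) d\<beta>\<close> for \<open>\<beta> \<in> S\<close>.  Measurability is part of the notion because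
  \<^const>\<open>cond_prob\<close> takes a default value on non-measurable events.
\<close>

definition has_cond_density_on ::
  "'a measure \<Rightarrow> ('a \<Rightarrow> real) \<Rightarrow> ('a \<Rightarrow> bool) \<Rightarrow> ('a \<Rightarrow> bool) \<Rightarrow> real set \<Rightarrow> (real \<Rightarrow> real) \<Rightarrow> bool" where
  "has_cond_density_on M X E A S f \<longleftrightarrow>
     X \<in> borel_measurable M \<and> Measurable.pred M E \<and> Measurable.pred M A \<and>
     set_integrable lborel S f \<and> (\<forall>\<beta>\<in>S. 0 \<le> f \<beta>) \<and>
     (\<forall>B\<in>sets borel. B \<subseteq> S \<longrightarrow>
        \<P>(\<omega> in M. X \<omega> \<in> B \<and> E \<omega> \<bar> A \<omega>) = (LINT \<beta>:B|lborel. f \<beta>))"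

end

theory Submission
  imports Defs "HOL-Real_Asymp.Real_Asymp"
begin

text \<open>
  Sampling \<open>N\<close> at the times \<open>j t / n\<close> replaces the telegraph process by a walk whose direction
  flips independently at each step, and which converges to it path by path.  For this walk the laws are exact:
  let \<open>a(P, Q)\<close> and \<open>b(P, Q)\<close> be the probabilities that the walk of \<open>P + Q + 1\<close> steps ends
  at \<open>Q - P + 1\<close> or above when it starts upwards, respectively downwards.  Conditioning on the first
  flip gives \<open>a(P, Q + 1) = q a(P, Q) + p b(P, Q)\<close> and \<open>b(P + 1, Q) = q b(P, Q) + p a(P, Q)\<close>,
  whence \<open>a = P(X \<ge> Y)\<close> and \<open>b = P(X > Y)\<close> for independent binomial variables \<open>X\<close>, \<open>Y\<close> with
  \<open>P\<close> and \<open>Q\<close> trials.  The tail of the maximum obeys the same recursion with the boundary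
  condition that it equals 1 for \<open>P = Q\<close>, and \<open>a + b\<close> satisfies this condition by symmetry; hence
  the maximum of the walk started upwards exceeds a level with probability \<open>a + b\<close>.
  Replacing \<open>p\<close> by \<open>- p\<close> separates the parities of the number of flips.  In the limit the
  binomial variables become Poisson variables, and differentiating the tails in the level gives the Bessel densities.
\<close>

section \<open>The discrete walk\<close>

text \<open>The reflection principle does not apply: the walk is persistent, and when it first
  reaches a positive level it is moving upwards, so its continuation is not symmetric. A recursion
  with boundary values takes the place of a path bijection. All discrete identities are polynomial
  in \<open>p\<close> and \<open>q\<close>. This is what makes \<open>- p\<close> admissible: the
  exact tails keep their form, and half the sum and half the difference of the two versions are the
  laws on an even and an odd number of flips. A cell of length h is a flip if N has an odd increment
  there, so p = (1 - exp (-2 rate h)) / 2. The number of flips in n cells then has exactly the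
  parity of N t; only the position is approximated, never the parity event. The walk has n + 1 steps
  for n flips; the last step lies beyond time t and costs O(h), but with it every flip determines a
  step. Pathwise convergence only compares tails at different levels. Since the limiting tails are
  continuous in the level, these comparisons still determine them, and the atom at c t stays outside
  the open interval of levels used.\<close>

fun flip_sum :: "real \<Rightarrow> real \<Rightarrow> (bool list \<Rightarrow> real) \<Rightarrow> nat \<Rightarrow> real" where
  "flip_sum p q f 0 = f []"
| "flip_sum p q f (Suc n) =
     q * flip_sum p q (\<lambda>l. f (False # l)) n + p * flip_sum p q (\<lambda>l. f (True # l)) n"

lemma flip_sum_cong:
  "(\<And>l. length l = n \<Longrightarrow> f l = g l) \<Longrightarrow> flip_sum p q f n = flip_sum p q g n"
proof (induction n arbitrary: f g)
  case (Suc n)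
  have "flip_sum p q (\<lambda>l. f (b # l)) n = flip_sum p q (\<lambda>l. g (b # l)) n" for b
    using Suc.prems by (intro Suc.IH) simp
  then show ?case by simp
qed simp

lemma flip_sum_add: "flip_sum p q (\<lambda>l. f l + g l) n = flip_sum p q f n + flip_sum p q g n"
  by (induction n arbitrary: f g) (simp_all add: algebra_simps)

lemma flip_sum_cmult: "flip_sum p q (\<lambda>l. k * f l) n = k * flip_sum p q f n"
  by (induction n arbitrary: f) (simp_all add: algebra_simps)

lemma flip_sum_const: "flip_sum p q (\<lambda>l. k) n = k * (p + q) ^ n"
  by (induction n) (simp_all add: algebra_simps)

text \<open>
  The weights may be negative: averaging over the signs of \<open>p\<close> extracts the parity of the number of flips.
\<close>

lemma flip_sum_uminus:
  "flip_sum (- p) q f n = flip_sum p q (\<lambda>l. (- 1) ^ count_list l True * f l) n"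
proof (induction n arbitrary: f)
  case (Suc n)
  show ?case
    using flip_sum_cmult[of p q "-1" "\<lambda>l. (- 1) ^ count_list l True * f (True # l)" n]
    by (simp add: Suc.IH mult.assoc)
qed simp

lemma flip_sum_even:
  "flip_sum p q (\<lambda>l. of_bool (E l \<and> even (count_list l True))) n
     = (flip_sum p q (\<lambda>l. of_bool (E l)) n + flip_sum (- p) q (\<lambda>l. of_bool (E l)) n) / 2"
proof -
  have "flip_sum p q (\<lambda>l. 2 * of_bool (E l \<and> even (count_list l True))) n
      = flip_sum p q (\<lambda>l. of_bool (E l) + (- 1) ^ count_list l True * of_bool (E l)) n"
    by (intro flip_sum_cong) auto
  then show ?thesis
    by (simp add: flip_sum_add flip_sum_uminus flip_sum_cmult)
qed

lemma flip_sum_odd: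
  "flip_sum p q (\<lambda>l. of_bool (E l \<and> odd (count_list l True))) n
     = (flip_sum p q (\<lambda>l. of_bool (E l)) n - flip_sum (- p) q (\<lambda>l. of_bool (E l)) n) / 2"
proof -
  have "flip_sum p q (\<lambda>l. 2 * of_bool (E l \<and> odd (count_list l True))) n
      = flip_sum p q (\<lambda>l. of_bool (E l) + (-1) * ((- 1) ^ count_list l True * of_bool (E l))) n"
    by (intro flip_sum_cong) auto
  then show ?thesis
    by (simp only: flip_sum_add flip_sum_uminus flip_sum_cmult) simp
qed

text \<open>
  A list of \<open>n\<close> flips determines \<open>n + 1\<close> steps, the first one being upwards; the walk started
  downwards is \<open>- psum l\<close>.
\<close>

definition psum :: "bool list \<Rightarrow> nat \<Rightarrow> int" where
  "psum l k = (\<Sum>j<k. (- 1) ^ count_list (take j l) True)"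

lemma psum_0 [simp]: "psum l 0 = 0"
  by (simp add: psum_def)

lemma psum_Cons [simp]: "psum (b # l) (Suc k) = 1 + (if b then - psum l k else psum l k)"
  by (simp add: psum_def sum.lessThan_Suc_shift sum_negf del: sum.lessThan_Suc)

lemma psum_Nil [simp]: "psum [] k = int k"
  by (simp add: psum_def)

lemma abs_psum_le: "\<bar>psum l k\<bar> \<le> int k"
proof -
  have "\<bar>psum l k\<bar> \<le> (\<Sum>j<k. \<bar>(- 1) ^ count_list (take j l) True :: int\<bar>)"
    unfolding psum_def by (rule sum_abs)
  then show ?thesis by simp
qed

text \<open>The first step is upwards whatever the flips are, so the other k steps start from 1.
  Both boundary cases of the recursion, \<open>P = 0\<close> and \<open>Q = 0\<close>, rest on
  this.\<close>

lemma abs_psum_Suc_le: "\<bar>psum l (Suc k) - 1\<bar> \<le> int k"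
proof (cases l)
  case (Cons b l')
  then show ?thesis using abs_psum_le[of l' k] by simp
qed simp

section \<open>Binomial tails as polynomials in the weights\<close>

fun binom_weight :: "real \<Rightarrow> real \<Rightarrow> nat \<Rightarrow> nat \<Rightarrow> real" where
  "binom_weight p q 0 0 = 1"
| "binom_weight p q 0 (Suc i) = 0"
| "binom_weight p q (Suc n) 0 = q * binom_weight p q n 0"
| "binom_weight p q (Suc n) (Suc i) = q * binom_weight p q n (Suc i) + p * binom_weight p q n i"

lemma binom_weight_eq_0: "n < i \<Longrightarrow> binom_weight p q n i = 0"
  by (induction p q n i rule: binom_weight.induct) auto

text \<open>The tail recursions use only Pascal's rule, which defines the weights; the closed form
  serves for the total mass and for the Poisson limit.\<close>

lemma binom_weight_eq: "binom_weight p q n i = real (n choose i) * p ^ i * q ^ (n - i)"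
proof (induction p q n i rule: binom_weight.induct)
  case (4 p q n i)
  show ?case
  proof (cases "i < n")
    case True
    then have "n - i = Suc (n - Suc i)" by simp
    then show ?thesis using 4 by (simp add: algebra_simps)
  next
    case False
    then show ?thesis using 4 by (auto simp: binom_weight_eq_0 not_less binomial_eq_0)
  qed
qed (simp_all add: Suc_diff_le)

definition binom_cum :: "real \<Rightarrow> real \<Rightarrow> nat \<Rightarrow> nat \<Rightarrow> real" where
  "binom_cum p q n m = (\<Sum>j<m. binom_weight p q n j)"

lemma binom_cum_0 [simp]: "binom_cum p q n 0 = 0"
  by (simp add: binom_cum_def)

lemma binom_cum_Suc: "binom_cum p q (Suc n) (Suc m) = q * binom_cum p q n (Suc m) + p * binom_cum p q n m"
  by (simp add: binom_cum_def sum.lessThan_Suc_shift sum.distrib sum_distrib_left algebra_simps del: sum.lessThan_Suc)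

lemma binom_cum_zero_left: "binom_cum p q 0 (Suc m) = 1"
  by (simp add: binom_cum_def sum.lessThan_Suc_shift del: sum.lessThan_Suc)

text \<open>
  For \<open>p, q \<ge> 0\<close> with \<open>p + q = 1\<close>, this is \<open>P(X \<ge> Y + k)\<close> for independent binomial variables
  \<open>X\<close>, \<open>Y\<close> with \<open>P\<close> and \<open>Q\<close> trials.  (For \<open>i < k\<close>, the truncated difference
  \<open>Suc i - k\<close> is 0 and the inner sum is empty.)
\<close>

definition bin_tail :: "real \<Rightarrow> real \<Rightarrow> nat \<Rightarrow> nat \<Rightarrow> nat \<Rightarrow> real" where
  "bin_tail p q k P Q = (\<Sum>i\<le>P. binom_weight p q P i * binom_cum p q Q (Suc i - k))"

text \<open>Condition on one additional trial of Y: its success raises the lead demanded of X from k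
  to k + 1.\<close>

lemma bin_tail_Suc_right:
  "bin_tail p q k P (Suc Q) = q * bin_tail p q k P Q + p * bin_tail p q (Suc k) P Q"
proof -
  \<comment> \<open>If \<open>Suc i <= k\<close>, all truncated differences are 0 and both sides
    vanish; otherwise this is the Pascal recursion for the cumulative weights.\<close>
  have "binom_cum p q (Suc Q) (Suc i - k) = q * binom_cum p q Q (Suc i - k) + p * binom_cum p q Q (Suc i - Suc k)" for i
  proof (cases "Suc i - k")
    case (Suc m)
    then have "Suc i - Suc k = m" by simp
    then show ?thesis by (simp only: Suc binom_cum_Suc)
  qed simp
  then show ?thesis
    by (simp add: bin_tail_def sum.distrib sum_distrib_left algebra_simps)
qed

lemma bin_tail_extend:
  "bin_tail p q k P Q = (\<Sum>i\<le>P + r. binom_weight p q P i * binom_cum p q Q (Suc i - k))"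
  unfolding bin_tail_def by (rule sum.mono_neutral_left) (auto simp: binom_weight_eq_0)

text \<open>Condition on one additional trial of X: its success lowers the demanded lead by one. The
  lead must be positive beforehand, since a negative lead has no counterpart in the natural number
  k.\<close>

lemma bin_tail_Suc_left:
  "bin_tail p q (Suc k) (Suc P) Q = q * bin_tail p q (Suc k) P Q + p * bin_tail p q k P Q"
proof -
  \<comment> \<open>Appending the null term i = P + 1 and dropping i = 0, whose inner sum is empty,
    aligns the index with the term coming from success.\<close>
  have "bin_tail p q (Suc k) P Q = (\<Sum>i\<le>P. binom_weight p q P (Suc i) * binom_cum p q Q (Suc i - k))"
    by (simp add: bin_tail_extend[of _ _ _ _ _ 1] sum.atMost_Suc_shift del: sum.atMost_Suc)
  moreover have "bin_tail p q (Suc k) (Suc P) Q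
      = (\<Sum>i\<le>P. (q * binom_weight p q P (Suc i) + p * binom_weight p q P i) * binom_cum p q Q (Suc i - k))"
    by (simp add: bin_tail_def sum.atMost_Suc_shift del: sum.atMost_Suc)
  ultimately show ?thesis
    by (simp add: bin_tail_def sum.distrib sum_distrib_left algebra_simps)
qed

lemma binom_weight_sum: "(\<Sum>i\<le>n. binom_weight p q n i) = (p + q) ^ n"
  by (simp add: binom_weight_eq binomial_ring)

lemma bin_tail_zero_right: "bin_tail p q 0 P 0 = (p + q) ^ P"
  by (simp add: bin_tail_def binom_cum_zero_left binom_weight_sum)

lemma bin_tail_zero_left: "bin_tail p q (Suc k) 0 Q = 0"
  by (simp add: bin_tail_def)

text \<open>Exchanging the two variables turns the pairs with j < i into those with j > i, which
  complement the pairs with j <= i in the full square.\<close>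

lemma bin_tail_diagonal: "bin_tail p q 0 n n + bin_tail p q 1 n n = (p + q) ^ (2 * n)"
proof -
  have "bin_tail p q 0 n n + bin_tail p q 1 n n =
     (\<Sum>i\<le>n. (\<Sum>j\<in>{..n}\<inter>{..<Suc i}. binom_weight p q n i * binom_weight p q n j)) + (\<Sum>i\<le>n. (\<Sum>j\<in>{..n}\<inter>{..<i}. binom_weight p q n i * binom_weight p q n j))"
    unfolding bin_tail_def binom_cum_def sum_distrib_left
    by (intro arg_cong2[where f="(+)"] sum.cong sum.mono_neutral_cong refl) (auto)
  also have "(\<Sum>i\<le>n. (\<Sum>j\<in>{..n}\<inter>{..<i}. binom_weight p q n i * binom_weight p q n j)) =
     (\<Sum>j\<le>n. (\<Sum>i\<in>{..n}\<inter>{j<..}. binom_weight p q n i * binom_weight p q n j))"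
    using sum.swap_restrict[of "{..n}" "{..n}" "\<lambda>i j. binom_weight p q n i * binom_weight p q n j" "\<lambda>i j. j < i"]
    by (simp add: Int_def)
  also have "(\<Sum>i\<le>n. (\<Sum>j\<in>{..n}\<inter>{..<Suc i}. binom_weight p q n i * binom_weight p q n j)) + \<dots>
     = (\<Sum>i\<le>n. (\<Sum>j\<le>n. binom_weight p q n i * binom_weight p q n j))"
    unfolding sum.distrib[symmetric]
  proof (rule sum.cong[OF refl])
    fix i assume "i \<in> {..n}"
    have e: "{..n} = ({..n}\<inter>{..<Suc i}) \<union> ({..n}\<inter>{i<..})" by auto
    have "(\<Sum>j\<le>n. binom_weight p q n i * binom_weight p q n j) = (\<Sum>j\<in>{..n}\<inter>{..<Suc i}. binom_weight p q n i * binom_weight p q n j) + (\<Sum>j\<in>{..n}\<inter>{i<..}. binom_weight p q n i * binom_weight p q n j)"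
      by (subst e, rule sum.union_disjoint) auto
    then show "(\<Sum>j\<in>{..n} \<inter> {..<Suc i}. binom_weight p q n i * binom_weight p q n j) + (\<Sum>j\<in>{..n} \<inter> {i<..}. binom_weight p q n j * binom_weight p q n i) = (\<Sum>j\<le>n. binom_weight p q n i * binom_weight p q n j)"
      by (simp add: mult.commute)
  qed
  also have "\<dots> = (p + q) ^ n * (p + q) ^ n"
    by (simp add: sum_product[symmetric] binom_weight_sum)
  finally show ?thesis by (simp add: mult_2 power_add)
qed

text \<open>A flip exchanges the two starting directions, so both conjuncts go through one
  induction. Removing the first step lowers the level by one for the upward start, which decreases
  Q, and raises it by one for the downward start, which decreases P.\<close>

lemma flip_sum_final:
  "flip_sum p q (\<lambda>l. of_bool (int Q - int P + 1 \<le> psum l (Suc (P + Q)))) (P + Q) = bin_tail p q 0 P Q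
   \<and> flip_sum p q (\<lambda>l. of_bool (int Q - int P + 1 \<le> - psum l (Suc (P + Q)))) (P + Q) = bin_tail p q 1 P Q"
proof (induction "P + Q" arbitrary: P Q)
  case 0
  then show ?case by (simp add: bin_tail_zero_right bin_tail_zero_left)
next
  case (Suc n)
  have "flip_sum p q (\<lambda>l. of_bool (int Q - int P + 1 \<le> psum l (Suc (P + Q)))) (P + Q) = bin_tail p q 0 P Q"
  proof (cases Q)
    case 0
    \<comment> \<open>The level is now 1 - P, the lowest endpoint of P + 1 steps that begin
      upwards.\<close>
    have "int Q - int P + 1 \<le> psum l (Suc (P + Q))" for l
      using abs_psum_Suc_le[of l P] 0 by simp
    then show ?thesis by (simp add: 0 flip_sum_const bin_tail_zero_right)
  next
    case (Suc Q')
    then have "n = P + Q'" using Suc.hyps by simp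
    note IH = Suc.hyps(1)[OF this]
    have "int Q - int P + 1 \<le> psum (b # l) (Suc (P + Q)) \<longleftrightarrow>
        int Q' - int P + 1 \<le> (if b then - psum l (Suc (P + Q')) else psum l (Suc (P + Q')))" for b l
      using Suc by auto
    then show ?thesis using IH by (simp add: Suc bin_tail_Suc_right algebra_simps)
  qed
  moreover have "flip_sum p q (\<lambda>l. of_bool (int Q - int P + 1 \<le> - psum l (Suc (P + Q)))) (P + Q) = bin_tail p q 1 P Q"
  proof (cases P)
    case 0
    have "\<not> int Q - int P + 1 \<le> - psum l (Suc (P + Q))" for l
      using abs_psum_Suc_le[of l Q] 0 by simp
    then show ?thesis by (simp add: 0 flip_sum_const bin_tail_zero_left)
  next
    case (Suc P')
    then have "n = P' + Q" using Suc.hyps by simp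
    note IH = Suc.hyps(1)[OF this]
    have "int Q - int P' \<le> - 1 - x \<longleftrightarrow> int Q - int P' < - x" for x
      by auto
    then show ?thesis using IH bin_tail_Suc_left[of p q 0 P' Q] by (simp add: Suc add1_zle_eq)
  qed
  ultimately show ?case by blast
qed

lemma ex_le_Suc: "(\<exists>k\<le>Suc n. Q k) \<longleftrightarrow> Q 0 \<or> (\<exists>k\<le>n. Q (Suc k))"
  by (metis Suc_le_mono le_SucE not0_implies_Suc zero_le)

text \<open>The downward start has the same sum with every k raised by one. This companion is what
  closes the induction: the recursions of \<open>bin_tail\<close> map the pair of sums with k in {0,
  1} and k in {1, 2} to itself, exactly as conditioning on the first flip does.
  \<open>P <= Q\<close> says that the level is positive, so that time 0 never counts.\<close>

lemma flip_sum_max: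
  assumes "P \<le> Q"
  shows "flip_sum p q (\<lambda>l. of_bool (\<exists>k\<le>Suc (P + Q). int Q - int P + 1 \<le> psum l k)) (P + Q)
      = bin_tail p q 0 P Q + bin_tail p q 1 P Q
   \<and> flip_sum p q (\<lambda>l. of_bool (\<exists>k\<le>Suc (P + Q). int Q - int P + 1 \<le> - psum l k)) (P + Q)
      = bin_tail p q 1 P Q + bin_tail p q 2 P Q"
  using assms
proof (induction "P + Q" arbitrary: P Q)
  case 0
  then show ?case by (simp add: bin_tail_zero_right bin_tail_zero_left ex_le_Suc numeral_2_eq_2)
next
  case (Suc n)
  have "flip_sum p q (\<lambda>l. of_bool (\<exists>k\<le>Suc (P + Q). int Q - int P + 1 \<le> psum l k)) (P + Q)
      = bin_tail p q 0 P Q + bin_tail p q 1 P Q"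
  proof (cases "P = Q")
    case True
    \<comment> \<open>For P = Q the level is 1 and the first step already attains it.\<close>
    have "1 \<le> psum l 1" for l by (cases l) (auto simp: psum_def)
    then have "\<exists>k\<le>Suc (P + Q). int Q - int P + 1 \<le> psum l k" for l
      using True by (intro exI[of _ 1]) auto
    then show ?thesis
      using bin_tail_diagonal[of p q Q] by (simp add: True flip_sum_const mult_2[symmetric])
  next
    case False
    then obtain Q' where Q: "Q = Suc Q'" "P \<le> Q'" using Suc.prems by (cases Q) auto
    then have "n = P + Q'" using Suc.hyps by simp
    note IH = Suc.hyps(1)[OF this \<open>P \<le> Q'\<close>]
    have "(\<exists>k\<le>Suc (P + Q). int Q - int P + 1 \<le> psum (b # l) k) \<longleftrightarrow>
        (\<exists>k\<le>Suc (P + Q'). int Q' - int P + 1 \<le> (if b then - psum l k else psum l k))" for b l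
    proof -
      have "int Q - int P + 1 \<le> psum (b # l) (Suc k) \<longleftrightarrow>
          int Q' - int P + 1 \<le> (if b then - psum l k else psum l k)" for k
        using Q by auto
      moreover have "\<not> int Q - int P + 1 \<le> psum (b # l) 0" using Q by simp
      moreover have "Suc (P + Q) = Suc (Suc (P + Q'))" using Q by simp
      ultimately show ?thesis by (simp only: ex_le_Suc[of "Suc (P + Q')"]) blast
    qed
    then show ?thesis
      using IH by (simp add: Q(1) bin_tail_Suc_right numeral_2_eq_2 algebra_simps)
  qed
  moreover have "flip_sum p q (\<lambda>l. of_bool (\<exists>k\<le>Suc (P + Q). int Q - int P + 1 \<le> - psum l k)) (P + Q)
      = bin_tail p q 1 P Q + bin_tail p q 2 P Q"
  proof (cases P)
    case 0
    have "\<not> int Q - int P + 1 \<le> - psum l k" if "k \<le> Suc (P + Q)" for l k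
      using abs_psum_Suc_le[of l "k - 1"] that 0 by (cases k) auto
    then have "\<not> (\<exists>k\<le>Suc (P + Q). int Q - int P + 1 \<le> - psum l k)" for l
      by blast
    then show ?thesis by (simp add: 0 flip_sum_const bin_tail_zero_left numeral_2_eq_2 del: not_ex)
  next
    case (Suc P')
    then have "n = P' + Q" "P' \<le> Q" using Suc.hyps Suc.prems by simp_all
    note IH = Suc.hyps(1)[OF this]
    have "(\<exists>k\<le>Suc (P + Q). int Q - int P + 1 \<le> - psum (b # l) k) \<longleftrightarrow>
        (\<exists>k\<le>Suc (P' + Q). int Q - int P' + 1 \<le> (if b then psum l k else - psum l k))" for b l
    proof -
      have "int Q - int P + 1 \<le> - psum (b # l) (Suc k) \<longleftrightarrow>
          int Q - int P' + 1 \<le> (if b then psum l k else - psum l k)" for k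
        using Suc by auto
      moreover have "\<not> int Q - int P + 1 \<le> - psum (b # l) 0" using Suc.prems by simp
      moreover have "Suc (P + Q) = Suc (Suc (P' + Q))" using Suc by simp
      ultimately show ?thesis by (simp only: ex_le_Suc[of "Suc (P' + Q)"]) blast
    qed
    then show ?thesis
      using IH by (simp add: Suc bin_tail_Suc_left numeral_2_eq_2 algebra_simps)
  qed
  ultimately show ?case by blast
qed

section \<open>The Poisson limit\<close>

definition exp_cum :: "nat \<Rightarrow> real \<Rightarrow> real" where
  "exp_cum m s = (\<Sum>j<m. s ^ j / fact j)"

text \<open>\<open>exp (- r - s) * pois_tail k r s\<close> is \<open>P(X \<ge> Y + k)\<close> for independent Poisson variables
  \<open>X\<close>, \<open>Y\<close> with means \<open>r\<close> and \<open>s\<close>.\<close>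

definition pois_tail :: "nat \<Rightarrow> real \<Rightarrow> real \<Rightarrow> real" where
  "pois_tail k r s = (\<Sum>i. r ^ i / fact i * exp_cum (Suc i - k) s)"

lemma sum_exp_le: "0 \<le> K \<Longrightarrow> (\<Sum>j<m. K ^ j / fact j) \<le> exp (K::real)"
  using sum_le_suminf[OF summable_exp_generic[of K], of "{..<m}"]
  by (simp add: exp_def divide_inverse mult.commute)

lemma abs_exp_cum_le:
  assumes "\<bar>s\<bar> \<le> K"
  shows "\<bar>exp_cum m s\<bar> \<le> exp K"
proof -
  have "\<bar>exp_cum m s\<bar> \<le> (\<Sum>j<m. \<bar>s ^ j / fact j\<bar>)"
    unfolding exp_cum_def by (rule sum_abs)
  also have "\<dots> \<le> (\<Sum>j<m. K ^ j / fact j)"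
    using assms by (intro sum_mono) (simp add: power_abs divide_right_mono power_mono)
  also have "\<dots> \<le> exp K"
    using assms by (intro sum_exp_le) simp
  finally show ?thesis .
qed

lemma summable_exp_cum_bound: "summable (\<lambda>i. K ^ i / fact i * L)" for K L :: real
  using summable_mult2[OF summable_exp_generic[of K], of L] by (simp add: divide_inverse mult.commute)

lemma summable_pois_tail: "summable (\<lambda>i. r ^ i / fact i * exp_cum (m i) s)"
proof (rule summable_comparison_test')
  show "summable (\<lambda>i. \<bar>r\<bar> ^ i / fact i * exp \<bar>s\<bar>)" by (rule summable_exp_cum_bound)
  show "norm (r ^ i / fact i * exp_cum (m i) s) \<le> \<bar>r\<bar> ^ i / fact i * exp \<bar>s\<bar>" for i
    unfolding norm_mult by (intro mult_mono) (auto simp: power_abs intro: abs_exp_cum_le)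
qed

text \<open>Successive terms have the quotient (\<rho> P - i \<rho>) / (i + 1), which tends to r /
  (i + 1). The sign of \<rho> is left open because the weight \<open>- p\<close> leads to negative
  values.\<close>

lemma binomial_mult_power_tendsto:
  fixes \<rho> :: "nat \<Rightarrow> real"
  assumes "(\<lambda>n. \<rho> n * real (P n)) \<longlonglongrightarrow> r" "\<rho> \<longlonglongrightarrow> 0"
  shows "(\<lambda>n. real (P n choose i) * \<rho> n ^ i) \<longlonglongrightarrow> r ^ i / fact i"
proof (induction i)
  case (Suc i)
  have "real (P n choose Suc i) * \<rho> n ^ Suc i
      = (real (P n choose i) * \<rho> n ^ i) * ((\<rho> n * real (P n) - real i * \<rho> n) / real (Suc i))" for n
  proof (cases "i \<le> P n")
    case True
    have "real (Suc i) * real (P n choose Suc i) = real (P n choose i) * (real (P n) - real i)"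
      using binomial_absorb_comp[of "P n" i] binomial_absorption[of i "P n"] True
      by (metis mult.commute of_nat_diff of_nat_mult)
    then have "real (P n choose Suc i) = real (P n choose i) * (real (P n) - real i) / real (Suc i)"
      by (simp add: field_simps)
    then show ?thesis by (simp add: algebra_simps)
  next
    case False
    then show ?thesis by (simp add: binomial_eq_0)
  qed
  moreover have "(\<lambda>n. (real (P n choose i) * \<rho> n ^ i) * ((\<rho> n * real (P n) - real i * \<rho> n) / real (Suc i)))
     \<longlonglongrightarrow> r ^ i / fact i * ((r - real i * 0) / real (Suc i))"
    by (intro tendsto_intros Suc.IH assms) simp
  ultimately have "(\<lambda>n. real (P n choose Suc i) * \<rho> n ^ Suc i)
      \<longlonglongrightarrow> r ^ i / fact i * ((r - real i * 0) / real (Suc i))"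
    by simp
  then show ?case by (simp add: field_simps)
qed simp

lemma abs_binomial_mult_power_le:
  assumes "\<bar>\<rho> * real P\<bar> \<le> K"
  shows "\<bar>real (P choose i) * \<rho> ^ i\<bar> \<le> K ^ i / fact i"
proof -
  have "real (P choose i) * fact i \<le> real P ^ i"
    using binomial_fact_pow[of P i] by (metis of_nat_fact of_nat_le_iff of_nat_mult of_nat_power)
  then have "real (P choose i) * \<bar>\<rho>\<bar> ^ i * fact i \<le> real P ^ i * \<bar>\<rho>\<bar> ^ i"
    by (metis mult.assoc mult.commute mult_right_mono zero_le_power abs_ge_zero)
  also have "\<dots> = \<bar>\<rho> * real P\<bar> ^ i"
    by (simp add: abs_mult power_mult_distrib)
  also have "\<dots> \<le> K ^ i"
    using assms by (intro power_mono) auto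
  finally show ?thesis by (simp add: abs_mult power_abs field_simps)
qed

text \<open>After all powers of q are taken out, p / q is the only parameter left. Written as a
  series over all i, in which the surplus binomial coefficients vanish, the sum has a range free of
  P and is ready for Tannery's theorem.\<close>

lemma bin_tail_eq:
  assumes "q \<noteq> 0"
  shows "bin_tail p q k P Q = q ^ (P + Q) *
    (\<Sum>i. real (P choose i) * (p / q) ^ i * (\<Sum>j<Suc i - k. real (Q choose j) * (p / q) ^ j))"
proof -
  have binom_weight: "binom_weight p q n i = q ^ n * (real (n choose i) * (p / q) ^ i)" for n i
  proof (cases "i \<le> n")
    case True
    then have "q ^ n = q ^ (n - i) * q ^ i" by (simp flip: power_add)
    then show ?thesis using assms by (simp add: binom_weight_eq power_divide)
  qed (simp add: binom_weight_eq_0 binomial_eq_0)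
  have "bin_tail p q k P Q = q ^ (P + Q) *
    (\<Sum>i\<le>P. real (P choose i) * (p / q) ^ i * (\<Sum>j<Suc i - k. real (Q choose j) * (p / q) ^ j))"
    unfolding bin_tail_def binom_cum_def binom_weight power_add
    by (simp add: sum_distrib_left mult_ac)
  also have "(\<Sum>i\<le>P. real (P choose i) * (p / q) ^ i * (\<Sum>j<Suc i - k. real (Q choose j) * (p / q) ^ j))
      = (\<Sum>i. real (P choose i) * (p / q) ^ i * (\<Sum>j<Suc i - k. real (Q choose j) * (p / q) ^ j))"
    by (rule suminf_finite[symmetric]) (auto simp: binomial_eq_0)
  finally show ?thesis .
qed

text \<open>Convergent sequences are bounded, say by K and L; then the i-th term is dominated by K^i
  / i! times exp L uniformly in n, and Tannery's theorem permits the termwise limit.\<close>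

lemma binomial_series_tendsto_pois_tail:
  fixes \<rho> :: "nat \<Rightarrow> real"
  assumes P: "(\<lambda>n. \<rho> n * real (P n)) \<longlonglongrightarrow> r" and Q: "(\<lambda>n. \<rho> n * real (Q n)) \<longlonglongrightarrow> s"
    and \<rho>: "\<rho> \<longlonglongrightarrow> 0"
  shows "(\<lambda>n. \<Sum>i. real (P n choose i) * \<rho> n ^ i * (\<Sum>j<Suc i - k. real (Q n choose j) * \<rho> n ^ j))
    \<longlonglongrightarrow> pois_tail k r s"
proof -
  obtain K where K: "\<bar>\<rho> n * real (P n)\<bar> \<le> K" for n
    using convergent_imp_Bseq[OF convergentI[OF P]] by (auto simp: Bseq_def)
  obtain L where L: "\<bar>\<rho> n * real (Q n)\<bar> \<le> L" for n
    using convergent_imp_Bseq[OF convergentI[OF Q]] by (auto simp: Bseq_def)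
  have L_nonneg: "0 \<le> L" using L[of 0] by linarith
  have K_nonneg: "0 \<le> K" using K[of 0] by linarith
  have *: "norm (real (P n choose i) * \<rho> n ^ i * (\<Sum>j<Suc i - k. real (Q n choose j) * \<rho> n ^ j))
      \<le> K ^ i / fact i * exp L" for n i
  proof -
    have "\<bar>\<Sum>j<Suc i - k. real (Q n choose j) * \<rho> n ^ j\<bar> \<le> (\<Sum>j<Suc i - k. \<bar>real (Q n choose j) * \<rho> n ^ j\<bar>)"
      by (rule sum_abs)
    also have "\<dots> \<le> (\<Sum>j<Suc i - k. L ^ j / fact j)"
      by (intro sum_mono abs_binomial_mult_power_le L)
    also have "\<dots> \<le> exp L" using L_nonneg by (rule sum_exp_le)
    finally show ?thesis
      unfolding real_norm_def abs_mult[of "_ * _" "sum _ _"]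
      by (intro mult_mono abs_binomial_mult_power_le K) (use K_nonneg in auto)
  qed
  have "((\<lambda>n. \<Sum>i. real (P n choose i) * \<rho> n ^ i * (\<Sum>j<Suc i - k. real (Q n choose j) * \<rho> n ^ j))
     \<longlongrightarrow> (\<Sum>i. r ^ i / fact i * exp_cum (Suc i - k) s)) sequentially"
  proof (rule tannerys_theorem[THEN conjunct2, THEN conjunct2])
    show "(\<lambda>n. real (P n choose i) * \<rho> n ^ i * (\<Sum>j<Suc i - k. real (Q n choose j) * \<rho> n ^ j))
        \<longlonglongrightarrow> r ^ i / fact i * exp_cum (Suc i - k) s" for i
      unfolding exp_cum_def
      by (intro tendsto_mult tendsto_sum binomial_mult_power_tendsto assms)
    show "\<forall>\<^sub>F (i, n) in at_top \<times>\<^sub>F sequentially. norm (real (P n choose i) * \<rho> n ^ i *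
           (\<Sum>j<Suc i - k. real (Q n choose j) * \<rho> n ^ j)) \<le> K ^ i / fact i * exp L"
      using * by (intro always_eventually) auto
    show "summable (\<lambda>i. K ^ i / fact i * exp L)" by (rule summable_exp_cum_bound)
  qed simp
  then show ?thesis by (simp only: pois_tail_def)
qed

text \<open>With x = \<kappa> / n, the quotient \<theta> is tanh x, so n \<theta> tends to \<kappa>,
  and q = exp (- x) cosh x, so q^n tends to exp (- \<kappa>). The factor \<epsilon> multiplies p
  only: for \<epsilon> = -1 the arguments of \<open>pois_tail\<close> change sign while the
  prefactor does not.\<close>

lemma bin_tail_tendsto:
  fixes \<kappa> \<epsilon> u v :: real
  assumes "0 < \<kappa>" and PQ: "\<And>n. P n + Q n = n"
    and P: "(\<lambda>n. real (P n) / real n) \<longlonglongrightarrow> u" and Q: "(\<lambda>n. real (Q n) / real n) \<longlonglongrightarrow> v"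
  shows "(\<lambda>n. bin_tail (\<epsilon> * ((1 - exp (- 2 * (\<kappa> / real n))) / 2)) ((1 + exp (- 2 * (\<kappa> / real n))) / 2) k (P n) (Q n))
    \<longlonglongrightarrow> exp (- \<kappa>) * pois_tail k (\<epsilon> * \<kappa> * u) (\<epsilon> * \<kappa> * v)"
proof -
  define q where "q n = (1 + exp (- 2 * (\<kappa> / real n))) / 2" for n
  define p where "p n = \<epsilon> * ((1 - exp (- 2 * (\<kappa> / real n))) / 2)" for n
  define \<theta> where "\<theta> n = (1 - exp (- 2 * (\<kappa> / real n))) / (1 + exp (- 2 * (\<kappa> / real n)))" for n
  have q0: "q n \<noteq> 0" for n
    using exp_gt_zero[of "- 2 * (\<kappa> / real n)"] unfolding q_def
    by (metis add_pos_pos divide_eq_0_iff less_numeral_extra(1,3) zero_neq_numeral)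
  have pq: "p n / q n = \<epsilon> * \<theta> n" for n
    by (simp add: p_def q_def \<theta>_def)
  have lim1: "(\<lambda>n. q n ^ n) \<longlonglongrightarrow> exp (- \<kappa>)"
    unfolding q_def using \<open>0 < \<kappa>\<close> by real_asymp
  have lim2: "(\<lambda>n. real n * \<theta> n) \<longlonglongrightarrow> \<kappa>"
    unfolding \<theta>_def using \<open>0 < \<kappa>\<close> by real_asymp
  have lim3: "\<theta> \<longlonglongrightarrow> 0"
    unfolding \<theta>_def using \<open>0 < \<kappa>\<close> by real_asymp
  have lim: "(\<lambda>n. (\<epsilon> * \<theta> n) * real (R n)) \<longlonglongrightarrow> \<epsilon> * \<kappa> * w"
    if "(\<lambda>n. real (R n) / real n) \<longlonglongrightarrow> w" for R :: "nat \<Rightarrow> nat" and w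
  proof -
    have "(\<lambda>n. \<epsilon> * (real n * \<theta> n) * (real (R n) / real n)) \<longlonglongrightarrow> \<epsilon> * \<kappa> * w"
      by (rule tendsto_mult[OF tendsto_mult[OF tendsto_const lim2] that])
    moreover have "\<forall>\<^sub>F n in sequentially. \<epsilon> * (real n * \<theta> n) * (real (R n) / real n) = (\<epsilon> * \<theta> n) * real (R n)"
      using eventually_gt_at_top[of 0] by eventually_elim simp
    ultimately show ?thesis by (rule Lim_transform_eventually)
  qed
  have "(\<lambda>n. q n ^ n * (\<Sum>i. real (P n choose i) * (\<epsilon> * \<theta> n) ^ i * (\<Sum>j<Suc i - k. real (Q n choose j) * (\<epsilon> * \<theta> n) ^ j)))
    \<longlonglongrightarrow> exp (- \<kappa>) * pois_tail k (\<epsilon> * \<kappa> * u) (\<epsilon> * \<kappa> * v)"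
  proof (intro tendsto_mult[OF lim1] binomial_series_tendsto_pois_tail lim[OF P] lim[OF Q])
    show "(\<lambda>n. \<epsilon> * \<theta> n) \<longlonglongrightarrow> 0" using tendsto_mult_left[OF lim3, of \<epsilon>] by simp
  qed
  then show ?thesis
    unfolding p_def[symmetric] q_def[symmetric] bin_tail_eq[OF q0] PQ pq .
qed

text \<open>\<open>I\<^sub>0(2 \<surd>y)\<close> and \<open>I\<^sub>1(2 \<surd>y) / \<surd>y\<close>, which unlike the Bessel functions of \<open>\<surd>y\<close> are visibly smooth at 0.\<close>

definition bess0 :: "real \<Rightarrow> real" where "bess0 y = (\<Sum>j. 1 / (fact j)\<^sup>2 * y ^ j)"

definition bess1 :: "real \<Rightarrow> real" where "bess1 y = (\<Sum>j. 1 / (fact j * fact (Suc j)) * y ^ j)"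

lemma summable_bess0: "summable (\<lambda>j. 1 / (fact j)\<^sup>2 * y ^ j)" for y :: real
proof (rule summable_comparison_test')
  show "summable (\<lambda>j. \<bar>y\<bar> ^ j / fact j * 1)" by (rule summable_exp_cum_bound)
  show "norm (1 / (fact j)\<^sup>2 * y ^ j) \<le> \<bar>y\<bar> ^ j / fact j * 1" for j
    using mult_left_mono[of 1 "fact j" "\<bar>y\<bar> ^ j :: real"]
    by (simp add: power2_eq_square power_abs field_simps)
qed

lemma diffs_bess0: "diffs (\<lambda>j. 1 / (fact j)\<^sup>2) = (\<lambda>j. 1 / (fact j * fact (Suc j)) :: real)"
  by (rule ext) (simp add: diffs_def power2_eq_square divide_simps del: of_nat_Suc)

lemma summable_bess1: "summable (\<lambda>j. 1 / (fact j * fact (Suc j)) * y ^ j)" for y :: real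
  using termdiff_converges_all[of "\<lambda>j. 1 / (fact j)\<^sup>2" y] summable_bess0 by (simp only: diffs_bess0)

lemma DERIV_bess0: "(bess0 has_real_derivative bess1 y) (at y)"
  using termdiffs_strong_converges_everywhere[of "\<lambda>j. 1 / (fact j)\<^sup>2" y] summable_bess0
  unfolding bess0_def[abs_def] bess1_def diffs_bess0 by simp

lemma isCont_bess1: "isCont bess1 y"
proof -
  have "isCont (\<lambda>x. \<Sum>j. 1 / (fact j * fact (Suc j)) * x ^ j) y"
    using isCont_powser_converges_everywhere[of "\<lambda>j. 1 / (fact j * fact (Suc j))" y] summable_bess1 by simp
  then show ?thesis unfolding bess1_def[abs_def] .
qed

lemma bess0_nonneg: "0 \<le> y \<Longrightarrow> 0 \<le> bess0 y"
  unfolding bess0_def by (intro suminf_nonneg summable_bess0) simp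

lemma bess1_nonneg: "0 \<le> y \<Longrightarrow> 0 \<le> bess1 y"
  unfolding bess1_def by (intro suminf_nonneg summable_bess1) simp

lemma bessel_I_0_eq:
  assumes "0 \<le> y"
  shows "bessel_I 0 (2 * sqrt y) = bess0 y"
proof -
  have G: "Gamma (real j + real 0 + 1) = fact j" for j
    using Gamma_fact[where ?'a = real, of j] by (simp add: add_ac)
  show ?thesis
    unfolding bessel_I_def bess0_def G using assms by (simp add: power_mult power2_eq_square)
qed

lemma bessel_I_1_eq: "0 \<le> y \<Longrightarrow> bessel_I 1 (2 * sqrt y) = sqrt y * bess1 y"
proof -
  assume y: "0 \<le> y"
  have G: "Gamma (real j + real 1 + 1) = fact (Suc j)" for j
    using Gamma_fact[where ?'a = real, of "Suc j"] by (simp add: add_ac)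
  have "bessel_I 1 (2 * sqrt y) = (\<Sum>j. sqrt y * (1 / (fact j * fact (Suc j)) * y ^ j))"
    unfolding bessel_I_def G using y by (simp add: power_mult power_add)
  also have "\<dots> = sqrt y * bess1 y"
    unfolding bess1_def by (rule suminf_mult[OF summable_bess1])
  finally show ?thesis .
qed

section \<open>Derivatives of the Poisson tails in the level\<close>

lemma DERIV_exp_term:
  "((\<lambda>x. x ^ i / fact i) has_real_derivative (case i of 0 \<Rightarrow> 0 | Suc j \<Rightarrow> x ^ j / fact j)) (at x)"
proof (cases i)
  case (Suc j)
  have "((\<lambda>x. x ^ Suc j / fact (Suc j)) has_real_derivative (real (Suc j) * x ^ j) / fact (Suc j)) (at x)"
    using DERIV_pow[of "Suc j" x] by (intro DERIV_cdivide) simp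
  then show ?thesis by (simp add: Suc del: of_nat_Suc)
qed simp

lemma DERIV_exp_cum: "(exp_cum m has_real_derivative exp_cum (m - 1) x) (at x)"
proof -
  have "((\<lambda>x. exp_cum m x) has_real_derivative (\<Sum>j<m. case j of 0 \<Rightarrow> 0 | Suc i \<Rightarrow> x ^ i / fact i)) (at x)"
    unfolding exp_cum_def by (intro DERIV_sum DERIV_exp_term)
  also have "(\<Sum>j<m. case j of 0 \<Rightarrow> 0 | Suc i \<Rightarrow> x ^ i / fact i) = exp_cum (m - 1) x"
    by (cases m) (simp_all add: exp_cum_def sum.lessThan_Suc_shift del: sum.lessThan_Suc)
  finally show ?thesis .
qed

lemma summable_exp_term_prec: "summable (\<lambda>i. case i of 0 \<Rightarrow> 0 | Suc j \<Rightarrow> K ^ j / fact j * L)" for K L :: real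
  using summable_exp_cum_bound[of K L] by (subst summable_Suc_iff[symmetric]) simp

text \<open>
  Termwise differentiation gives two series; shifting the index of the first one by 1 leaves differences
  of \<^const>\<open>exp_cum\<close> with at most two terms.
\<close>

lemma DERIV_pois_tail:
  fixes A B x :: real and k :: nat
  defines "r \<equiv> A - B * x" and "s \<equiv> A + B * x"
  shows "((\<lambda>x. pois_tail k (A - B * x) (A + B * x)) has_real_derivative
     - B * (\<Sum>i. r ^ i / fact i * (exp_cum (Suc (Suc i) - k) s - exp_cum (Suc i - k - 1) s))) (at x)"
proof -
  \<comment> \<open>The interval must contain x in its interior and also 0, where convergence of the
    series itself is supplied; K bounds both linear arguments on it.\<close>
  define R where "R = \<bar>x\<bar> + 1"
  define K where "K = \<bar>A\<bar> + \<bar>B\<bar> * R"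
  define f' where "f' i x = - B * ((case i of 0 \<Rightarrow> 0 | Suc j \<Rightarrow> (A - B * x) ^ j / fact j) * exp_cum (Suc i - k) (A + B * x))
     + B * ((A - B * x) ^ i / fact i * exp_cum (Suc i - k - 1) (A + B * x))" for i x
  define M where "M i = \<bar>B\<bar> * (case i of 0 \<Rightarrow> 0 | Suc j \<Rightarrow> K ^ j / fact j * exp K) + \<bar>B\<bar> * (K ^ i / fact i * exp K)" for i
  have K_nonneg: "0 \<le> K" by (simp add: K_def R_def)
  have bound: "\<bar>A - B * y\<bar> \<le> K" "\<bar>A + B * y\<bar> \<le> K" if "y \<in> {-R<..<R}" for y
  proof -
    have "\<bar>B * y\<bar> \<le> \<bar>B\<bar> * R"
      unfolding abs_mult using that by (intro mult_left_mono) auto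
    then show "\<bar>A - B * y\<bar> \<le> K" "\<bar>A + B * y\<bar> \<le> K" unfolding K_def by linarith+
  qed
  have "((\<lambda>x. \<Sum>i. (A - B * x) ^ i / fact i * exp_cum (Suc i - k) (A + B * x)) has_real_derivative (\<Sum>i. f' i x)) (at x)"
  proof (rule has_field_derivative_series'(2))
    show "convex {-R<..<R}" by simp
    show "((\<lambda>x. (A - B * x) ^ i / fact i * exp_cum (Suc i - k) (A + B * x)) has_real_derivative f' i y) (at y within {-R<..<R})" for i y
    proof -
      have d: "((\<lambda>x. A - B * x) has_real_derivative - B) (at y)" "((\<lambda>x. A + B * x) has_real_derivative B) (at y)"
        by (auto intro!: derivative_eq_intros)
      show ?thesis
        unfolding f'_def
        by (rule DERIV_cong[OF DERIV_subset[OF DERIV_mult[OF DERIV_chain2[OF DERIV_exp_term[of i] d(1)]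
              DERIV_chain2[OF DERIV_exp_cum[of "Suc i - k"] d(2)]] subset_UNIV]]) (simp only: mult_ac mult_minus_left mult_minus_right)
    qed
    show "uniformly_convergent_on {-R<..<R} (\<lambda>n x. \<Sum>i<n. f' i x)"
    proof (rule Weierstrass_m_test')
      show "summable M"
        unfolding M_def by (intro summable_add summable_mult summable_exp_term_prec summable_exp_cum_bound)
      show "norm (f' i y) \<le> M i" if "y \<in> {-R<..<R}" for i y
      proof -
        have p: "\<bar>(A - B * y) ^ j / fact j * exp_cum m (A + B * y)\<bar> \<le> K ^ j / fact j * exp K" for j m
          unfolding abs_mult using bound[OF that] K_nonneg
          by (intro mult_mono abs_exp_cum_le) (auto simp: power_abs intro!: divide_right_mono power_mono)
        let ?a = "(case i of 0 \<Rightarrow> 0 | Suc j \<Rightarrow> (A - B * y) ^ j / fact j) * exp_cum (Suc i - k) (A + B * y)"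
        let ?b = "(A - B * y) ^ i / fact i * exp_cum (Suc i - k - 1) (A + B * y)"
        have "\<bar>?a\<bar> \<le> (case i of 0 \<Rightarrow> 0 | Suc j \<Rightarrow> K ^ j / fact j * exp K)"
          using p by (cases i) auto
        then have "\<bar>B\<bar> * \<bar>?a\<bar> + \<bar>B\<bar> * \<bar>?b\<bar> \<le> M i"
          unfolding M_def by (intro add_mono mult_left_mono p) auto
        moreover have "\<bar>- B * ?a + B * ?b\<bar> \<le> \<bar>B\<bar> * \<bar>?a\<bar> + \<bar>B\<bar> * \<bar>?b\<bar>"
          using abs_triangle_ineq[of "- B * ?a" "B * ?b"] by (simp only: abs_mult abs_minus_cancel)
        ultimately show ?thesis unfolding f'_def real_norm_def by linarith
      qed
    qed
    show "0 \<in> {-R<..<R}" using abs_ge_zero[of x] unfolding R_def greaterThanLessThan_iff by linarith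
    show "summable (\<lambda>i. (A - B * 0) ^ i / fact i * exp_cum (Suc i - k) (A + B * 0))"
      by (rule summable_pois_tail)
    show "x \<in> interior {-R<..<R}" by (auto simp: R_def)
  qed
  moreover have "(\<Sum>i. f' i x) = - B * (\<Sum>i. r ^ i / fact i * (exp_cum (Suc (Suc i) - k) s - exp_cum (Suc i - k - 1) s))"
  proof -
    have "(\<lambda>i. r ^ i / fact i * exp_cum (Suc (Suc i) - k) s) sums (\<Sum>i. r ^ i / fact i * exp_cum (Suc (Suc i) - k) s)"
      by (intro summable_sums summable_pois_tail)
    then have 1: "(\<lambda>i. (case i of 0 \<Rightarrow> 0 | Suc j \<Rightarrow> r ^ j / fact j) * exp_cum (Suc i - k) s) sums
       (\<Sum>i. r ^ i / fact i * exp_cum (Suc (Suc i) - k) s)"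
      using sums_Suc[of "\<lambda>i. (case i of 0 \<Rightarrow> 0 | Suc j \<Rightarrow> r ^ j / fact j) * exp_cum (Suc i - k) s"] by simp
    have 2: "(\<lambda>i. r ^ i / fact i * exp_cum (Suc i - k - 1) s) sums (\<Sum>i. r ^ i / fact i * exp_cum (Suc i - k - 1) s)"
      by (intro summable_sums summable_pois_tail)
    have "(\<Sum>i. f' i x) = - B * (\<Sum>i. r ^ i / fact i * exp_cum (Suc (Suc i) - k) s) + B * (\<Sum>i. r ^ i / fact i * exp_cum (Suc i - k - 1) s)"
      unfolding f'_def r_def[symmetric] s_def[symmetric]
      by (rule sums_unique[symmetric]) (intro sums_add sums_mult 1 2)
    also have "\<dots> = - B * ((\<Sum>i. r ^ i / fact i * exp_cum (Suc (Suc i) - k) s) - (\<Sum>i. r ^ i / fact i * exp_cum (Suc i - k - 1) s))"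
      by (simp add: algebra_simps)
    also have "\<dots> = - B * (\<Sum>i. r ^ i / fact i * (exp_cum (Suc (Suc i) - k) s - exp_cum (Suc i - k - 1) s))"
      by (subst suminf_diff[OF summable_pois_tail summable_pois_tail]) (simp only: right_diff_distrib)
    finally show ?thesis .
  qed
  ultimately show ?thesis unfolding pois_tail_def by simp
qed

lemma bess0_mult: "bess0 (r * s) = (\<Sum>i. r ^ i / fact i * (s ^ i / fact i))"
  by (simp add: bess0_def power_mult_distrib power2_eq_square)

lemma bess1_mult: "s * bess1 (r * s) = (\<Sum>i. r ^ i / fact i * (s ^ Suc i / fact (Suc i)))"
proof -
  have "s * bess1 (r * s) = (\<Sum>i. s * (1 / (fact i * fact (Suc i)) * (r * s) ^ i))"
    unfolding bess1_def by (rule suminf_mult[OF summable_bess1, symmetric])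
  then show ?thesis by (simp add: power_mult_distrib mult_ac del: fact_Suc)
qed

text \<open>For k = 0 the difference of cumulative sums keeps the terms j = i and j = i + 1. Paired
  with r^i / i!, the first gives the diagonal series \<open>bess0\<close> and the second the
  off-diagonal series s \<open>bess1\<close>.\<close>

lemma DERIV_pois_tail_0:
  "((\<lambda>x. pois_tail 0 (A - B * x) (A + B * x)) has_real_derivative
     - B * (bess0 ((A - B * x) * (A + B * x)) + (A + B * x) * bess1 ((A - B * x) * (A + B * x)))) (at x)"
proof -
  define r s where "r = A - B * x" and "s = A + B * x"
  have "(\<Sum>i. r ^ i / fact i * (exp_cum (Suc (Suc i) - 0) s - exp_cum (Suc i - 0 - 1) s))
     = (\<Sum>i. r ^ i / fact i * (s ^ i / fact i) + r ^ i / fact i * (s ^ Suc i / fact (Suc i)))"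
    by (simp add: exp_cum_def algebra_simps del: fact_Suc)
  also have "\<dots> = bess0 (r * s) + s * bess1 (r * s)"
    unfolding bess0_mult bess1_mult
  proof (rule suminf_add[symmetric])
    show "summable (\<lambda>i. r ^ i / fact i * (s ^ i / fact i))"
      using summable_bess0[of "r * s"] by (simp add: power_mult_distrib power2_eq_square)
    show "summable (\<lambda>i. r ^ i / fact i * (s ^ Suc i / fact (Suc i)))"
      using summable_mult[OF summable_bess1[of "r * s"], of s] by (simp add: power_mult_distrib mult_ac del: fact_Suc)
  qed
  finally show ?thesis using DERIV_pois_tail[of 0 A B x] by (simp only: r_def s_def)
qed

lemma DERIV_pois_tail_1:
  "((\<lambda>x. pois_tail 1 (A - B * x) (A + B * x)) has_real_derivative
     - B * (bess0 ((A - B * x) * (A + B * x)) + (A - B * x) * bess1 ((A - B * x) * (A + B * x)))) (at x)"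
proof -
  define r s where "r = A - B * x" and "s = A + B * x"
  have sum1: "summable (\<lambda>i. s ^ i / fact i * (r ^ Suc i / fact (Suc i)))"
    using summable_mult[OF summable_bess1[of "r * s"], of r] by (simp add: power_mult_distrib mult_ac del: fact_Suc)
  have sum1': "summable (\<lambda>i. case i of 0 \<Rightarrow> 0 | Suc j \<Rightarrow> s ^ j / fact j * (r ^ Suc j / fact (Suc j)))"
    using sum1 by (subst summable_Suc_iff[symmetric]) simp
  \<comment> \<open>Here the terms j = i and j = i - 1 survive. At i = 0 the truncated index leaves
    only one of them, so the off-diagonal series starts at i = 1; after a shift it carries the
    factor r instead of s.\<close>
  have e: "exp_cum (Suc (Suc i) - 1) s - exp_cum (Suc i - 1 - 1) s
      = s ^ i / fact i + (case i of 0 \<Rightarrow> 0 | Suc j \<Rightarrow> s ^ j / fact j)" for i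
    by (cases i) (simp_all add: exp_cum_def)
  have "(\<Sum>i. r ^ i / fact i * (exp_cum (Suc (Suc i) - 1) s - exp_cum (Suc i - 1 - 1) s))
     = (\<Sum>i. r ^ i / fact i * (s ^ i / fact i) + (case i of 0 \<Rightarrow> 0 | Suc j \<Rightarrow> s ^ j / fact j * (r ^ Suc j / fact (Suc j))))"
    unfolding e by (intro suminf_cong) (simp add: distrib_left mult_ac del: fact_Suc split: nat.split)
  also have "\<dots> = bess0 (r * s) + (\<Sum>i. case i of 0 \<Rightarrow> 0 | Suc j \<Rightarrow> s ^ j / fact j * (r ^ Suc j / fact (Suc j)))"
    unfolding bess0_mult
  proof (rule suminf_add[symmetric])
    show "summable (\<lambda>i. r ^ i / fact i * (s ^ i / fact i))"
      using summable_bess0[of "r * s"] by (simp add: power_mult_distrib power2_eq_square)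
  qed (fact sum1')
  also have "(\<Sum>i. case i of 0 \<Rightarrow> 0 | Suc j \<Rightarrow> s ^ j / fact j * (r ^ Suc j / fact (Suc j))) = r * bess1 (r * s)"
    using suminf_split_head[OF sum1'] by (simp only: nat.case diff_zero bess1_mult mult.commute[of r s])
  finally show ?thesis using DERIV_pois_tail[of 1 A B x] by (simp only: r_def s_def)
qed

text \<open>At the level c t the first Poisson mean is 0, so only the term i = 0 remains. These
  values give the mass of the atom.\<close>

lemma pois_tail_zero_left: "pois_tail 0 0 s = 1" "pois_tail 1 0 s = 0"
proof -
  have "pois_tail k 0 s = exp_cum (1 - k) s" for k
    unfolding pois_tail_def by (subst suminf_finite[of "{0}"]) auto
  then show "pois_tail 0 0 s = 1" "pois_tail 1 0 s = 0" by (simp_all add: exp_cum_def)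
qed

section \<open>Discretisation of the paths\<close>

definition dir_int :: "(real \<Rightarrow> nat) \<Rightarrow> real \<Rightarrow> real" where
  "dir_int k s = (LINT u:{0..s}|lborel. (- 1) ^ k u)"

lemma telegraph_eq: "telegraph V0 N s \<omega> = V0 \<omega> * dir_int (\<lambda>u. N u \<omega>) s"
  by (simp add: telegraph_def dir_int_def)

context
  fixes k :: "real \<Rightarrow> nat"
  assumes mono: "mono_on {0..} k"
begin

lemma set_integrable_parity: "set_integrable lborel {0..s} (\<lambda>u. (- 1) ^ k u :: real)"
proof -
  \<comment> \<open>The cosine expresses the parity as a continuous function of a real monotone,
    hence measurable, path; \<open>max 0 u\<close> extends the path monotonically to the whole
    line.\<close>
  define g where "g u = cos (pi * real (k (max 0 u)))" for u
  have "mono (\<lambda>u. real (k (max 0 u)))"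
    by (intro monoI) (auto intro!: mono_onD[OF mono])
  from borel_measurable_mono[OF this] have "g \<in> borel_measurable lborel"
    unfolding g_def by measurable
  then have "set_integrable lborel {0..s} g"
    unfolding set_integrable_def
    by (rule integrableI_bounded_set_indicator[where B=1, rotated]) (auto simp: g_def emeasure_lborel_Icc_eq)
  then show ?thesis
    by (rule set_integrable_cong[THEN iffD1, rotated -1]) (auto simp: g_def cos_npi2 max_def mult.commute)
qed

lemma parity_integrable_on: "0 \<le> a \<Longrightarrow> (\<lambda>u. (- 1) ^ k u :: real) integrable_on {a..b}"
  by (rule integrable_subinterval_real[OF set_borel_integral_eq_integral(1)[OF set_integrable_parity[of b]]]) auto

lemma dir_int_eq: "dir_int k s = integral {0..s} (\<lambda>u. (- 1) ^ k u)"
  unfolding dir_int_def by (rule set_borel_integral_eq_integral(2)[OF set_integrable_parity])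

lemma dir_int_0 [simp]: "dir_int k 0 = 0"
  by (simp add: dir_int_eq)

lemma dir_int_diff:
  assumes "0 \<le> a" "a \<le> b"
  shows "dir_int k b - dir_int k a = integral {a..b} (\<lambda>u. (- 1) ^ k u)"
  using Henstock_Kurzweil_Integration.integral_combine[OF assms parity_integrable_on[of 0 b]] by (simp add: dir_int_eq)

lemma abs_dir_int_diff_le:
  assumes "0 \<le> a" "a \<le> b"
  shows "\<bar>dir_int k b - dir_int k a\<bar> \<le> b - a"
proof -
  have "norm (integral {a..b} (\<lambda>u. (- 1) ^ k u :: real)) \<le> integral {a..b} (\<lambda>u. 1)"
    using assms by (intro integral_norm_bound_integral parity_integrable_on) (auto simp: norm_power)
  then show ?thesis using assms by (simp add: dir_int_diff)
qed

lemma abs_dir_int_le: "0 \<le> s \<Longrightarrow> \<bar>dir_int k s\<bar> \<le> s"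
  using abs_dir_int_diff_le[of 0 s] by simp

lemma continuous_on_dir_int: "continuous_on {0..} (dir_int k)"
proof (rule continuous_onI)
  fix x e :: real assume "x \<in> {0..}" "0 < e"
  have "dist (dir_int k x') (dir_int k x) \<le> \<bar>x' - x\<bar>" if "0 \<le> x'" for x'
    using abs_dir_int_diff_le[of x x'] abs_dir_int_diff_le[of x' x] that \<open>x \<in> {0..}\<close>
    by (cases "x \<le> x'") (auto simp: dist_real_def abs_minus_commute)
  then show "\<exists>d>0. \<forall>x'\<in>{0..}. dist x' x < d \<longrightarrow> dist (dir_int k x') (dir_int k x) \<le> e"
    using \<open>0 < e\<close> by (intro exI[of _ e]) (auto simp: dist_real_def intro: order_trans less_imp_le)
qed

text \<open>Without a jump in the cell the direction is constant and the error is 0; with a jump,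
  two quantities of size at most b - a are compared and the increment is at least 1. Charging the
  error to the increment of k makes it telescope over a grid.\<close>

lemma dir_int_step:
  assumes "0 \<le> a" "a \<le> b"
  shows "\<bar>dir_int k b - dir_int k a - (b - a) * (- 1) ^ k a\<bar> \<le> 2 * (b - a) * (real (k b) - real (k a))"
proof (cases "k a = k b")
  case True
  have "k u = k a" if "u \<in> {a..b}" for u
  proof (rule antisym)
    show "k u \<le> k a" unfolding True using that assms by (intro mono_onD[OF mono]) auto
    show "k a \<le> k u" using that assms by (intro mono_onD[OF mono]) auto
  qed
  then have "integral {a..b} (\<lambda>u. (- 1) ^ k u :: real) = integral {a..b} (\<lambda>u. (- 1) ^ k a)"
    by (intro integral_cong) (simp only:)
  then show ?thesis using True assms by (simp add: dir_int_diff)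
next
  case False
  then have "1 \<le> real (k b) - real (k a)"
    using mono_onD[OF mono, of a b] assms by simp
  then have "2 * (b - a) * 1 \<le> 2 * (b - a) * (real (k b) - real (k a))"
    using assms by (intro mult_left_mono) auto
  moreover have "\<bar>(b - a) * (- 1) ^ k a\<bar> = b - a"
    using assms by (simp add: abs_mult power_abs)
  moreover have "\<bar>dir_int k b - dir_int k a - y\<bar> \<le> z"
    if "2 * (b - a) * 1 \<le> z" "\<bar>y\<bar> = b - a" for y z
    using abs_triangle_ineq4[of "dir_int k b - dir_int k a" y] abs_dir_int_diff_le[OF assms] that by simp
  ultimately show ?thesis by blast
qed

lemma dir_int_riemann:
  assumes "0 \<le> h"
  shows "\<bar>dir_int k (real m * h) - h * (\<Sum>j<m. (- 1) ^ k (real j * h))\<bar> \<le> 2 * h * (real (k (real m * h)) - real (k 0))"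
proof (induction m)
  case (Suc m)
  have "\<bar>dir_int k (real (Suc m) * h) - dir_int k (real m * h) - h * (- 1) ^ k (real m * h)\<bar>
      \<le> 2 * h * (real (k (real (Suc m) * h)) - real (k (real m * h)))"
    using dir_int_step[of "real m * h" "real (Suc m) * h"] assms by (simp add: algebra_simps)
  then show ?case using Suc by (simp add: algebra_simps)
qed simp

end

section \<open>Sampling a path on a grid\<close>

definition flips :: "nat \<Rightarrow> real \<Rightarrow> (real \<Rightarrow> nat) \<Rightarrow> bool list" where
  "flips n h k = map (\<lambda>j. odd (k (real (Suc j) * h) - k (real j * h))) [0..<n]"

lemma length_flips [simp]: "length (flips n h k) = n"
  by (simp add: flips_def)

lemma count_list_append_single: "count_list (xs @ [x]) y = count_list xs y + of_bool (x = y)"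
  by (induction xs) auto

context
  fixes k :: "real \<Rightarrow> nat"
  assumes mono: "mono_on {0..} k" and zero: "k 0 = 0"
begin

text \<open>The parities of the increments add up, starting from \<open>k 0 = 0\<close>. The parity
  of the path at a grid point is therefore recovered without any error.\<close>

lemma even_count_flips:
  assumes "0 \<le> h" "j \<le> n"
  shows "even (count_list (take j (flips n h k)) True) \<longleftrightarrow> even (k (real j * h))"
  using assms(2)
proof (induction j)
  case (Suc j)
  have "take (Suc j) (flips n h k) = take j (flips n h k) @ [odd (k (real (Suc j) * h) - k (real j * h))]"
    using Suc.prems by (simp add: flips_def take_map take_Suc_conv_app_nth)
  moreover have "k (real j * h) \<le> k (real (Suc j) * h)"
    using assms(1) by (intro mono_onD[OF mono]) (auto intro: mult_right_mono)
  ultimately show ?case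
    using Suc by (simp add: count_list_append_single del: of_nat_Suc)
qed (simp add: zero)

lemma psum_flips:
  assumes "0 \<le> h" "m \<le> Suc n"
  shows "psum (flips n h k) m = (\<Sum>j<m. (- 1) ^ k (real j * h))"
  unfolding psum_def
proof (intro sum.cong refl)
  fix j assume "j \<in> {..<m}"
  then have "even (count_list (take j (flips n h k)) True) \<longleftrightarrow> even (k (real j * h))"
    using assms by (intro even_count_flips) auto
  then show "(- 1 :: int) ^ count_list (take j (flips n h k)) True = (- 1) ^ k (real j * h)"
    by (cases "even (k (real j * h))") auto
qed

lemma dir_int_psum:
  assumes "0 \<le> h" "m \<le> n"
  shows "\<bar>dir_int k (real m * h) - h * psum (flips n h k) m\<bar> \<le> 2 * h * real (k (real n * h))"
proof -
  have "\<bar>dir_int k (real m * h) - h * psum (flips n h k) m\<bar> \<le> 2 * h * real (k (real m * h))"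
    using dir_int_riemann[OF mono assms(1), of m] assms by (simp add: psum_flips zero)
  also have "k (real m * h) \<le> k (real n * h)"
    using assms by (intro mono_onD[OF mono]) (auto intro: mult_right_mono)
  then have "2 * h * real (k (real m * h)) \<le> 2 * h * real (k (real n * h))"
    using assms(1) by (intro mult_left_mono) auto
  finally show ?thesis .
qed

lemma psum_flips_Suc:
  assumes "0 \<le> h" "m \<le> n"
  shows "\<bar>psum (flips n h k) (Suc m) - psum (flips n h k) m\<bar> = 1"
  using assms by (simp add: psum_flips power_abs)

lemma dir_int_psum_Suc:
  assumes "0 \<le> h"
  shows "\<bar>dir_int k (real n * h) - h * psum (flips n h k) (Suc n)\<bar> \<le> 2 * h * real (k (real n * h)) + h"
proof -
  have "\<bar>real_of_int (psum (flips n h k) (Suc n) - psum (flips n h k) n)\<bar> = 1"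
    using psum_flips_Suc[OF assms, of n n] by (simp del: of_int_diff)
  then have "\<bar>h * psum (flips n h k) (Suc n) - h * psum (flips n h k) n\<bar> = h"
    using assms by (simp add: right_diff_distrib[symmetric] abs_mult)
  then show ?thesis using dir_int_psum[OF assms, of n n] by linarith
qed

lemma dir_int_limit:
  assumes "0 \<le> t"
  shows "(\<lambda>n. t / real n * psum (flips n (t / real n) k) (Suc n)) \<longlonglongrightarrow> dir_int k t"
proof (rule Lim_null[THEN iffD2, OF Lim_null_comparison])
  show "\<forall>\<^sub>F n in sequentially. norm (t / real n * psum (flips n (t / real n) k) (Suc n) - dir_int k t)
      \<le> 2 * (t / real n) * real (k t) + t / real n"
    using eventually_gt_at_top[of 0]
  proof eventually_elim
    case (elim n)
    then show ?case using dir_int_psum_Suc[of "t / real n" n] assms by (simp add: abs_minus_commute)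
  qed
  show "(\<lambda>n. 2 * (t / real n) * real (k t) + t / real n) \<longlonglongrightarrow> 0"
    by real_asymp
qed

text \<open>The errors are all of order h: rounding a time down to the grid, the Riemann error at a
  grid point, and the step of the walk that lies beyond t.\<close>

lemma running_max_psum:
  assumes "0 < t" "0 < n" "0 \<le> c"
  defines "h \<equiv> t / real n"
  shows "\<bar>(SUP s\<in>{0..t}. c * dir_int k s) - c * h * Max (psum (flips n h k) ` {..Suc n})\<bar> \<le> c * (2 * h * real (k t) + 2 * h)"
proof -
  let ?m = "Max (psum (flips n h k) ` {..Suc n})" and ?e = "2 * h * real (k t)"
  have h: "0 < h" "real n * h = t" using assms by (auto simp: h_def)
  have bdd: "bdd_above ((\<lambda>s. c * dir_int k s) ` {0..t})"
  proof (rule bdd_aboveI2)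
    fix s assume "s \<in> {0..t}"
    then have "dir_int k s \<le> t" using abs_dir_int_le[OF mono, of s] by auto
    then show "c * dir_int k s \<le> c * t" using \<open>0 \<le> c\<close> by (rule mult_left_mono)
  qed
  have "c * dir_int k s \<le> c * (h * ?m + ?e + h)" if s: "s \<in> {0..t}" for s
  proof -
    define m where "m = nat \<lfloor>s / h\<rfloor>"
    have m: "real m \<le> s / h" "s / h < real m + 1"
    proof -
      have "0 \<le> s / h" using s h by simp
      then have "real m = of_int \<lfloor>s / h\<rfloor>" by (simp add: m_def of_nat_nat)
      then show "real m \<le> s / h" "s / h < real m + 1" by linarith+
    qed
    then have m': "real m * h \<le> s" "s < real m * h + h"
      using h by (simp_all add: pos_le_divide_eq pos_divide_less_eq distrib_right)
    have "real m * h \<le> t" using m'(1) s by simp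
    then have "real m * h \<le> real n * h" by (simp only: h(2))
    then have "m \<le> n" using h(1) by simp
    then have "psum (flips n h k) m \<le> ?m" by (intro Max_ge) auto
    then have "h * psum (flips n h k) m \<le> h * ?m" using h(1) by (intro mult_left_mono) auto
    moreover have "\<bar>dir_int k (real m * h) - h * psum (flips n h k) m\<bar> \<le> ?e"
      using dir_int_psum[of h m n] h \<open>m \<le> n\<close> by simp
    moreover have "\<bar>dir_int k s - dir_int k (real m * h)\<bar> \<le> s - real m * h"
      using m' h by (intro abs_dir_int_diff_le[OF mono]) auto
    ultimately have "dir_int k s \<le> h * ?m + ?e + h" using m' by linarith
    then show ?thesis using \<open>0 \<le> c\<close> by (rule mult_left_mono)
  qed
  then have 1: "(SUP s\<in>{0..t}. c * dir_int k s) \<le> c * (h * ?m + ?e + h)"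
    using assms(1) by (intro cSUP_least) auto
  have "?m \<in> psum (flips n h k) ` {..Suc n}" by (rule Max_in) auto
  then obtain m where "?m = psum (flips n h k) m" "m \<in> {..Suc n}" by (rule imageE)
  then have m: "m \<le> Suc n" "?m = psum (flips n h k) m" by auto
  \<comment> \<open>The maximum may sit at \<open>Suc n\<close>, after time t; going back one step
    changes the walk by 1 only.\<close>
  define m' where "m' = min m n"
  have "?m \<le> psum (flips n h k) m' + 1"
  proof (cases "m \<le> n")
    case False
    then have "m = Suc n" "m' = n" using m(1) by (auto simp: m'_def)
    then show ?thesis using psum_flips_Suc[of h n n] h unfolding m(2) by simp
  qed (simp add: m(2) m'_def)
  then have "real_of_int ?m \<le> real_of_int (psum (flips n h k) m') + 1" by linarith
  then have "h * ?m \<le> h * (real_of_int (psum (flips n h k) m') + 1)"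
    using h(1) by (intro mult_left_mono) auto
  then have "h * ?m \<le> h * psum (flips n h k) m' + h"
    by (simp only: distrib_left mult_1_right)
  moreover have "\<bar>dir_int k (real m' * h) - h * psum (flips n h k) m'\<bar> \<le> ?e"
    using dir_int_psum[of h m' n] h by (simp add: m'_def)
  ultimately have "h * ?m - ?e - h \<le> dir_int k (real m' * h)" by linarith
  then have "c * (h * ?m - ?e - h) \<le> c * dir_int k (real m' * h)"
    using \<open>0 \<le> c\<close> by (rule mult_left_mono)
  also have "\<dots> \<le> (SUP s\<in>{0..t}. c * dir_int k s)"
  proof (rule cSUP_upper[OF _ bdd])
    have "real m' * h \<le> real n * h" using h by (intro mult_right_mono) (auto simp: m'_def)
    then show "real m' * h \<in> {0..t}" using h by auto
  qed
  finally have 2: "c * (h * ?m - ?e - h) \<le> (SUP s\<in>{0..t}. c * dir_int k s)" .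
  have 3: "0 \<le> c * h" using assms(3) h by simp
  show ?thesis
  proof -
    have e: "c * (h * x + y + h) = c * h * x + c * (y + h)" "c * (h * x - y - h) = c * h * x - c * (y + h)"
      "c * (y + 2 * h) = c * (y + h) + c * h" for x y
      by (simp_all add: algebra_simps)
    show ?thesis using 1 2 3 unfolding e abs_le_iff by linarith
  qed
qed

lemma running_max_limit:
  assumes "0 < t" "0 \<le> c"
  shows "(\<lambda>n. c * (t / real n) * Max (psum (flips n (t / real n) k) ` {..Suc n})) \<longlonglongrightarrow> (SUP s\<in>{0..t}. c * dir_int k s)"
proof (rule Lim_null[THEN iffD2, OF Lim_null_comparison])
  show "\<forall>\<^sub>F n in sequentially. norm (c * (t / real n) * Max (psum (flips n (t / real n) k) ` {..Suc n}) - (SUP s\<in>{0..t}. c * dir_int k s))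
      \<le> c * (2 * (t / real n) * real (k t) + 2 * (t / real n))"
    using eventually_gt_at_top[of 0]
  proof eventually_elim
    case (elim n)
    then show ?case using running_max_psum[OF assms(1) elim assms(2)] by (simp add: abs_minus_commute)
  qed
  show "(\<lambda>n. c * (2 * (t / real n) * real (k t) + 2 * (t / real n))) \<longlonglongrightarrow> 0"
    by real_asymp
qed

end

text \<open>The integral is a pathwise limit of Riemann sums, each involving finitely many N s. The
  measure space F is left general because the statement is needed both for M and for the
  sigma-algebra generated by N, the one independent of the initial velocity.\<close>

lemma borel_measurable_dir_int:
  assumes N: "\<And>s. 0 \<le> s \<Longrightarrow> N s \<in> measurable F (count_space UNIV)"
    and "\<And>\<omega>. \<omega> \<in> space F \<Longrightarrow> mono_on {0..} (\<lambda>s. N s \<omega>)"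
    and "\<And>\<omega>. \<omega> \<in> space F \<Longrightarrow> N 0 \<omega> = 0" and "0 \<le> s"
  shows "(\<lambda>\<omega>. dir_int (\<lambda>u. N u \<omega>) s) \<in> borel_measurable F"
proof (rule borel_measurable_LIMSEQ_real)
  show "(\<lambda>n. s / real n * psum (flips n (s / real n) (\<lambda>u. N u \<omega>)) (Suc n)) \<longlonglongrightarrow> dir_int (\<lambda>u. N u \<omega>) s"
    if "\<omega> \<in> space F" for \<omega>
    using assms that by (intro dir_int_limit) auto
  show "(\<lambda>\<omega>. s / real n * psum (flips n (s / real n) (\<lambda>u. N u \<omega>)) (Suc n)) \<in> borel_measurable F" for n
  proof -
    have [measurable]: "N (real j * (s / real n)) \<in> measurable F (count_space UNIV)" for j
      using \<open>0 \<le> s\<close> by (intro N) simp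
    have "(\<lambda>\<omega>. s / real n * (\<Sum>j<Suc n. (- 1) ^ N (real j * (s / real n)) \<omega>)) \<in> borel_measurable F"
      by measurable
    then show ?thesis
      by (rule measurable_cong[THEN iffD1, rotated]) (use assms in \<open>simp add: psum_flips del: sum.lessThan_Suc\<close>)
  qed
qed

lemma borel_measurable_running_max:
  assumes N: "\<And>s. 0 \<le> s \<Longrightarrow> N s \<in> measurable F (count_space UNIV)"
    and mono: "\<And>\<omega>. \<omega> \<in> space F \<Longrightarrow> mono_on {0..} (\<lambda>s. N s \<omega>)"
    and zero: "\<And>\<omega>. \<omega> \<in> space F \<Longrightarrow> N 0 \<omega> = 0" and "0 < t" and V: "V \<in> borel_measurable F"
  shows "running_max (telegraph V N) t \<in> borel_measurable F"
proof -
  have [measurable]: "(\<lambda>\<omega>. dir_int (\<lambda>u. N u \<omega>) s) \<in> borel_measurable F" if "0 \<le> s" for s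
    using assms that by (intro borel_measurable_dir_int) auto
  note V [measurable]
  \<comment> \<open>By continuity of the paths, the supremum over the dense countable set I equals
    the supremum over [0, t].\<close>
  define I where "I = {0<..<t} \<inter> \<rat>"
  have I: "countable I" "I \<noteq> {}" "I \<subseteq> {0..t}"
    using Rats_dense_in_real[OF \<open>0 < t\<close>] by (auto simp: I_def countable_rat)
  have cl: "closure I = {0..t}"
    unfolding I_def using \<open>0 < t\<close> by (subst closure_open_Int_superset) (auto simp: Rats_closure_real)
  have bdd: "bdd_above ((\<lambda>s. V \<omega> * dir_int (\<lambda>u. N u \<omega>) s) ` J)" if "\<omega> \<in> space F" "J \<subseteq> {0..t}" for \<omega> J
  proof (rule bdd_aboveI2)
    fix s assume "s \<in> J"
    then have "\<bar>dir_int (\<lambda>u. N u \<omega>) s\<bar> \<le> t"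
      using abs_dir_int_le[OF mono, of \<omega> s] that by force
    then have "\<bar>V \<omega> * dir_int (\<lambda>u. N u \<omega>) s\<bar> \<le> \<bar>V \<omega>\<bar> * t"
      unfolding abs_mult by (intro mult_left_mono) auto
    then show "V \<omega> * dir_int (\<lambda>u. N u \<omega>) s \<le> \<bar>V \<omega>\<bar> * t" by linarith
  qed
  have "running_max (telegraph V N) t \<omega> = (SUP s\<in>I. V \<omega> * dir_int (\<lambda>u. N u \<omega>) s)" if \<omega>: "\<omega> \<in> space F" for \<omega>
    unfolding running_max_def telegraph_eq
  proof (rule antisym)
    show "(SUP s\<in>{0..t}. V \<omega> * dir_int (\<lambda>u. N u \<omega>) s) \<le> (SUP s\<in>I. V \<omega> * dir_int (\<lambda>u. N u \<omega>) s)"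
    proof (rule cSUP_least)
      fix s assume "s \<in> {0..t}"
      show "V \<omega> * dir_int (\<lambda>u. N u \<omega>) s \<le> (SUP s\<in>I. V \<omega> * dir_int (\<lambda>u. N u \<omega>) s)"
      proof (rule continuous_le_on_closure[where f = "\<lambda>s. V \<omega> * dir_int (\<lambda>u. N u \<omega>) s" and S = I])
        show "continuous_on (closure I) (\<lambda>s. V \<omega> * dir_int (\<lambda>u. N u \<omega>) s)"
          unfolding cl by (intro continuous_intros continuous_on_subset[OF continuous_on_dir_int[OF mono[OF \<omega>]]]) auto
        show "s \<in> closure I" using \<open>s \<in> {0..t}\<close> cl by simp
      qed (rule cSUP_upper[OF _ bdd[OF \<omega> I(3)]])
    qed (use \<open>0 < t\<close> in auto)
    show "(SUP s\<in>I. V \<omega> * dir_int (\<lambda>u. N u \<omega>) s) \<le> (SUP s\<in>{0..t}. V \<omega> * dir_int (\<lambda>u. N u \<omega>) s)"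
      using I \<omega> by (intro cSUP_subset_mono bdd) auto
  qed
  moreover have "(\<lambda>\<omega>. SUP s\<in>I. V \<omega> * dir_int (\<lambda>u. N u \<omega>) s) \<in> borel_measurable F"
    using I bdd by (intro borel_measurable_cSUP) auto
  ultimately show ?thesis
    by (subst measurable_cong) auto
qed

section \<open>Laws of the discretised process\<close>

lemma flip_sum_eq_sum:
  "flip_sum p q f n = (\<Sum>l | length l = n. (\<Prod>b\<leftarrow>l. if b then p else q) * f l)"
proof (induction n arbitrary: f)
  case (Suc n)
  have fin: "finite {l :: bool list. length l = n}"
    using finite_lists_length_eq[of "UNIV :: bool set" n] by simp
  have split: "{l :: bool list. length l = Suc n}
      = (\<lambda>l. False # l) ` {l. length l = n} \<union> (\<lambda>l. True # l) ` {l. length l = n}"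
    by (auto simp: length_Suc_conv)
  show ?case
    unfolding split using fin
    by (subst sum.union_disjoint)
       (auto simp: sum.reindex inj_on_def Suc.IH sum_distrib_left mult.assoc)
qed simp

text \<open>The odd part of the exponential series is sinh.\<close>

lemma prob_poisson_odd:
  assumes "0 < \<mu>"
  shows "measure_pmf.prob (poisson_pmf \<mu>) {k. odd k} = (1 - exp (- 2 * \<mu>)) / 2"
proof -
  define A where "A n = (if odd n then {n :: nat} else {})" for n
  have "(\<Union>n. A n) = {k. odd k}" by (auto simp: A_def split: if_splits)
  moreover have "(\<lambda>n. measure_pmf.prob (poisson_pmf \<mu>) (A n)) sums measure_pmf.prob (poisson_pmf \<mu>) (\<Union>n. A n)"
    by (rule measure_pmf.finite_measure_UNION) (auto simp: A_def disjoint_family_on_def)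
  moreover have "measure_pmf.prob (poisson_pmf \<mu>) (A n) = exp (- \<mu>) * (if even n then 0 else \<mu> ^ n /\<^sub>R fact n)" for n
    using assms by (simp add: A_def measure_pmf_single divide_inverse mult_ac)
  ultimately have "(\<lambda>n. exp (- \<mu>) * (if even n then 0 else \<mu> ^ n /\<^sub>R fact n)) sums measure_pmf.prob (poisson_pmf \<mu>) {k. odd k}"
    by simp
  moreover have "(\<lambda>n. exp (- \<mu>) * (if even n then 0 else \<mu> ^ n /\<^sub>R fact n)) sums (exp (- \<mu>) * sinh \<mu>)"
    by (intro sums_mult sinh_converges)
  ultimately have "measure_pmf.prob (poisson_pmf \<mu>) {k. odd k} = exp (- \<mu>) * sinh \<mu>"
    by (rule sums_unique2)
  also have "\<dots> = (1 - exp (- 2 * \<mu>)) / 2"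
    by (simp add: sinh_field_def right_diff_distrib flip: exp_add)
  finally show ?thesis .
qed

context poisson_process
begin

lemma prob_odd_increment:
  assumes "0 \<le> s" "s < t"
  shows "prob {\<omega> \<in> space M. odd (N t \<omega> - N s \<omega>)} = (1 - exp (- 2 * (rate * (t - s)))) / 2"
proof -
  have [measurable]: "N s \<in> measurable M (count_space UNIV)" "N t \<in> measurable M (count_space UNIV)"
    using assms by (auto intro: measurable_N)
  have "prob {\<omega> \<in> space M. odd (N t \<omega> - N s \<omega>)}
      = measure (distr M (count_space UNIV) (\<lambda>\<omega>. N t \<omega> - N s \<omega>)) {k. odd k}"
    by (subst measure_distr) (auto intro!: arg_cong[where f = prob])
  also have "\<dots> = (1 - exp (- 2 * (rate * (t - s)))) / 2"
    unfolding N_increment[OF assms] using assms rate_pos by (intro prob_poisson_odd) simp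
  finally show ?thesis .
qed

lemma flips_eq_iff:
  "length l = n \<Longrightarrow> flips n h k = l \<longleftrightarrow> (\<forall>i<n. odd (k (real (Suc i) * h) - k (real i * h)) = l ! i)"
  by (auto simp: flips_def list_eq_iff_nth_eq)

lemma flips_events:
  assumes "0 \<le> h"
  shows "{\<omega> \<in> space M. E (flips n h (\<lambda>s. N s \<omega>))} \<in> events"
proof -
  have [measurable]: "N (real i * h) \<in> measurable M (count_space UNIV)" for i
    using assms by (intro measurable_N) simp
  have fin: "finite {l :: bool list. length l = n \<and> E l}"
    by (rule finite_subset[OF _ finite_lists_length_eq[of "UNIV :: bool set" n]]) auto
  have "{\<omega> \<in> space M. E (flips n h (\<lambda>s. N s \<omega>))} =
      (\<Union>l\<in>{l. length l = n \<and> E l}. {\<omega> \<in> space M. \<forall>i<n. odd (N (real (Suc i) * h) \<omega> - N (real i * h) \<omega>) = l ! i})"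
  proof -
    have "E (flips n h k) \<longleftrightarrow> (\<exists>l. (length l = n \<and> E l) \<and> (\<forall>i<n. odd (k (real (Suc i) * h) - k (real i * h)) = l ! i))" for k
      using flips_eq_iff by (metis length_flips)
    then show ?thesis by (auto simp del: of_nat_Suc)
  qed
  also have "\<dots> \<in> events"
    using fin by (intro sets.finite_UN) measurable
  finally show ?thesis .
qed

lemma prob_flips_eq:
  assumes "0 < h" "length l = n"
  defines "p \<equiv> (1 - exp (- 2 * (rate * h))) / 2" and "q \<equiv> (1 + exp (- 2 * (rate * h))) / 2"
  shows "prob {\<omega> \<in> space M. flips n h (\<lambda>s. N s \<omega>) = l} = (\<Prod>b\<leftarrow>l. if b then p else q)"
\<comment> \<open>An intersection over the empty index set is \<open>UNIV\<close> instead of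
  \<open>space M\<close>, so the product rule is applied for positive n only.\<close>
proof (cases "n = 0")
  case True
  then show ?thesis using assms by (simp add: flips_def prob_space)
next
  case False
  define X where "X i \<omega> = N (real (Suc i) * h) \<omega> - N (real i * h) \<omega>" for i \<omega>
  have meas [measurable]: "N (real i * h) \<in> measurable M (count_space UNIV)" for i
    using assms by (intro measurable_N) simp
  have [measurable]: "X i \<in> measurable M (count_space UNIV)" for i
    unfolding X_def by measurable
  have "indep_vars (\<lambda>_. count_space UNIV) X {..<n}"
    unfolding X_def
    by (rule N_indep_increments[of "\<lambda>i. real i * h"]) (use assms in \<open>auto intro!: monoI mult_right_mono\<close>)
  then have "prob (\<Inter>i<n. X i -` {m. odd m = l ! i} \<inter> space M) = (\<Prod>i<n. prob (X i -` {m. odd m = l ! i} \<inter> space M))"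
    using False by (intro indep_varsD_finite[where M' = "\<lambda>_. count_space UNIV"]) auto
  moreover have "(\<Inter>i<n. X i -` {m. odd m = l ! i} \<inter> space M) = {\<omega> \<in> space M. flips n h (\<lambda>s. N s \<omega>) = l}"
    using False by (auto simp: flips_eq_iff[OF assms(2)] X_def)
  moreover have "prob (X i -` {m. odd m = b} \<inter> space M) = (if b then p else q)" for i b
  proof -
    have odd: "prob {\<omega> \<in> space M. odd (X i \<omega>)} = p"
      unfolding X_def p_def using assms(1) prob_odd_increment[of "real i * h" "real (Suc i) * h"]
      by (simp add: algebra_simps)
    then have "prob {\<omega> \<in> space M. \<not> odd (X i \<omega>)} = 1 - p"
      by (subst prob_neg) auto
    also have "1 - p = q" by (simp add: p_def q_def field_simps)
    finally show ?thesis using odd by (cases b) (auto simp: vimage_def Int_def conj_commute)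
  qed
  ultimately have "prob {\<omega> \<in> space M. flips n h (\<lambda>s. N s \<omega>) = l} = (\<Prod>i<n. if l ! i then p else q)"
    by simp
  also have "\<dots> = (\<Prod>b\<leftarrow>l. if b then p else q)"
    using assms(2) by (simp add: prod.list_conv_set_nth atLeast0LessThan)
  finally show ?thesis .
qed

lemma prob_flips:
  assumes "0 < h"
  shows "prob {\<omega> \<in> space M. E (flips n h (\<lambda>s. N s \<omega>))}
    = flip_sum ((1 - exp (- 2 * (rate * h))) / 2) ((1 + exp (- 2 * (rate * h))) / 2) (\<lambda>l. of_bool (E l)) n"
proof -
  have fin: "finite {l :: bool list. length l = n}"
    using finite_lists_length_eq[of "UNIV :: bool set" n] by simp
  have "{\<omega> \<in> space M. E (flips n h (\<lambda>s. N s \<omega>))} =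
      (\<Union>l\<in>{l. length l = n \<and> E l}. {\<omega> \<in> space M. flips n h (\<lambda>s. N s \<omega>) = l})"
    by auto
  also have "prob \<dots> = (\<Sum>l | length l = n \<and> E l. prob {\<omega> \<in> space M. flips n h (\<lambda>s. N s \<omega>) = l})"
    using fin flips_events[OF less_imp_le[OF assms]]
    by (intro finite_measure_finite_Union) (auto simp: disjoint_family_on_def)
  also have "\<dots> = (\<Sum>l | length l = n. prob {\<omega> \<in> space M. flips n h (\<lambda>s. N s \<omega>) = l} * of_bool (E l))"
    using fin by (intro sum.mono_neutral_cong_left) auto
  also have "\<dots> = flip_sum ((1 - exp (- 2 * (rate * h))) / 2) ((1 + exp (- 2 * (rate * h))) / 2) (\<lambda>l. of_bool (E l)) n"
    unfolding flip_sum_eq_sum by (intro sum.cong refl) (simp add: prob_flips_eq[OF assms])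
  finally show ?thesis .
qed

end

section \<open>From pathwise convergence to tails and densities\<close>

context prob_space
begin

text \<open>Pathwise convergence does not control the indicator of a half-line at its endpoint. The
  continuous ramp \<phi>, 0 below a and 1 above b, lies between the indicators at b and at a, and
  its expectations converge by dominated convergence.\<close>

lemma tail_limit_bounds:
  fixes Y :: "'a \<Rightarrow> real"
  assumes [measurable]: "Y \<in> borel_measurable M" "\<And>n. Z n \<in> borel_measurable M" "Measurable.pred M E"
    and lim: "\<And>\<omega>. \<omega> \<in> space M \<Longrightarrow> (\<lambda>n. Z n \<omega>) \<longlonglongrightarrow> Y \<omega>" and "a < b"
  shows "(\<lambda>n. prob {\<omega> \<in> space M. a \<le> Z n \<omega> \<and> E \<omega>}) \<longlonglongrightarrow> L \<Longrightarrow> prob {\<omega> \<in> space M. b \<le> Y \<omega> \<and> E \<omega>} \<le> L"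
    and "(\<lambda>n. prob {\<omega> \<in> space M. b \<le> Z n \<omega> \<and> E \<omega>}) \<longlonglongrightarrow> L \<Longrightarrow> L \<le> prob {\<omega> \<in> space M. a \<le> Y \<omega> \<and> E \<omega>}"
proof -
  define \<phi> where "\<phi> y = max 0 (min 1 ((y - a) / (b - a)))" for y
  have \<phi>: "0 \<le> \<phi> y" "\<phi> y \<le> 1" "y < a \<Longrightarrow> \<phi> y = 0" "b \<le> y \<Longrightarrow> \<phi> y = 1" for y
    using \<open>a < b\<close> by (auto simp: \<phi>_def field_simps max_def min_def)
  have cont: "continuous_on UNIV \<phi>" unfolding \<phi>_def using \<open>a < b\<close> by (intro continuous_intros) auto
  then have [measurable]: "\<phi> \<in> borel_measurable borel" by (rule borel_measurable_continuous_onI)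
  have int: "integrable M (\<lambda>\<omega>. \<phi> (X \<omega>) * indicator {\<omega>. E \<omega>} \<omega>)" if [measurable]: "X \<in> borel_measurable M" for X
    using \<phi> by (intro integrable_const_bound[where B = 1]) (auto simp: indicator_def)
  have upper: "prob {\<omega> \<in> space M. b \<le> X \<omega> \<and> E \<omega>} \<le> (\<integral>\<omega>. \<phi> (X \<omega>) * indicator {\<omega>. E \<omega>} \<omega> \<partial>M)"
    if [measurable]: "X \<in> borel_measurable M" for X
  proof -
    have "prob {\<omega> \<in> space M. b \<le> X \<omega> \<and> E \<omega>} = (\<integral>\<omega>. indicator {\<omega> \<in> space M. b \<le> X \<omega> \<and> E \<omega>} \<omega> \<partial>M)"
      by simp
    also have "\<dots> \<le> (\<integral>\<omega>. \<phi> (X \<omega>) * indicator {\<omega>. E \<omega>} \<omega> \<partial>M)"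
    proof (intro integral_mono int that)
      show "integrable M (indicator {\<omega> \<in> space M. b \<le> X \<omega> \<and> E \<omega>} :: 'a \<Rightarrow> real)"
        by (intro integrable_real_indicator) (auto simp: emeasure_eq_measure)
    qed (use \<phi> in \<open>auto simp: indicator_def\<close>)
    finally show ?thesis .
  qed
  have lower: "(\<integral>\<omega>. \<phi> (X \<omega>) * indicator {\<omega>. E \<omega>} \<omega> \<partial>M) \<le> prob {\<omega> \<in> space M. a \<le> X \<omega> \<and> E \<omega>}"
    if [measurable]: "X \<in> borel_measurable M" for X
  proof -
    have "(\<integral>\<omega>. \<phi> (X \<omega>) * indicator {\<omega>. E \<omega>} \<omega> \<partial>M) \<le> (\<integral>\<omega>. indicator {\<omega> \<in> space M. a \<le> X \<omega> \<and> E \<omega>} \<omega> \<partial>M)"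
    proof (intro integral_mono int that)
      show "integrable M (indicator {\<omega> \<in> space M. a \<le> X \<omega> \<and> E \<omega>} :: 'a \<Rightarrow> real)"
        by (intro integrable_real_indicator) (auto simp: emeasure_eq_measure)
    qed (use \<phi> in \<open>auto simp: indicator_def not_le\<close>)
    then show ?thesis by simp
  qed
  have conv: "(\<lambda>n. \<integral>\<omega>. \<phi> (Z n \<omega>) * indicator {\<omega>. E \<omega>} \<omega> \<partial>M) \<longlonglongrightarrow> (\<integral>\<omega>. \<phi> (Y \<omega>) * indicator {\<omega>. E \<omega>} \<omega> \<partial>M)"
  proof (rule integral_dominated_convergence[where w = "\<lambda>_. 1"])
    show "AE \<omega> in M. (\<lambda>n. \<phi> (Z n \<omega>) * indicator {\<omega>. E \<omega>} \<omega>) \<longlonglongrightarrow> \<phi> (Y \<omega>) * indicator {\<omega>. E \<omega>} \<omega>"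
      using cont lim
      by (intro AE_I2 tendsto_mult tendsto_const) (auto intro: continuous_on_tendsto_compose)
  qed (use \<phi> in \<open>auto simp: indicator_def\<close>)
  show "prob {\<omega> \<in> space M. b \<le> Y \<omega> \<and> E \<omega>} \<le> L"
    if "(\<lambda>n. prob {\<omega> \<in> space M. a \<le> Z n \<omega> \<and> E \<omega>}) \<longlonglongrightarrow> L"
    using upper[of Y] LIMSEQ_le[OF conv that] lower[of "Z _"] by force
  show "L \<le> prob {\<omega> \<in> space M. a \<le> Y \<omega> \<and> E \<omega>}"
    if "(\<lambda>n. prob {\<omega> \<in> space M. b \<le> Z n \<omega> \<and> E \<omega>}) \<longlonglongrightarrow> L"
    using lower[of Y] LIMSEQ_le[OF that conv] upper[of "Z _"] by force
qed

text \<open>Compare the level x with levels y on either side of it, then let y tend to x using the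
  continuity of g. The approximating sequence may depend on y, as the lattice adapted to a level
  does.\<close>

lemma tail_limit:
  fixes Y :: "'a \<Rightarrow> real"
  assumes Y: "Y \<in> borel_measurable M" and E: "Measurable.pred M E"
    and S: "open S" "continuous_on S g" "x \<in> S"
    and approx: "\<And>y. y \<in> S \<Longrightarrow> \<exists>Z. (\<forall>n. Z n \<in> borel_measurable M) \<and> (\<forall>\<omega>\<in>space M. (\<lambda>n. Z n \<omega>) \<longlonglongrightarrow> Y \<omega>)
       \<and> (\<lambda>n. prob {\<omega> \<in> space M. y \<le> Z n \<omega> \<and> E \<omega>}) \<longlonglongrightarrow> g y"
  shows "prob {\<omega> \<in> space M. x \<le> Y \<omega> \<and> E \<omega>} = g x"
proof (rule antisym)
  have g: "isCont g x" using S continuous_on_eq_continuous_at by blast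
  have S': "\<forall>\<^sub>F y in at x within T. y \<in> S" for T
    using S by (meson eventually_at_topological)
  have left: "\<forall>\<^sub>F y in at_left x. y < x" and right: "\<forall>\<^sub>F y in at_right x. x < y"
    by (simp_all add: eventually_at_filter)
  have ub: "\<forall>\<^sub>F y in at_left x. prob {\<omega> \<in> space M. x \<le> Y \<omega> \<and> E \<omega>} \<le> g y"
    using S'[of "{..<x}"] left
  proof eventually_elim
    case (elim y)
    obtain Z where "\<And>n. Z n \<in> borel_measurable M" "\<And>\<omega>. \<omega> \<in> space M \<Longrightarrow> (\<lambda>n. Z n \<omega>) \<longlonglongrightarrow> Y \<omega>"
      "(\<lambda>n. prob {\<omega> \<in> space M. y \<le> Z n \<omega> \<and> E \<omega>}) \<longlonglongrightarrow> g y"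
      using approx[OF elim(1)] by blast
    then show ?case using tail_limit_bounds(1)[OF Y _ E _ elim(2)] by blast
  qed
  show "prob {\<omega> \<in> space M. x \<le> Y \<omega> \<and> E \<omega>} \<le> g x"
    by (rule tendsto_lowerbound[OF _ ub]) (use g in \<open>auto simp: isCont_def intro: filterlim_mono at_le\<close>)
  have lb: "\<forall>\<^sub>F y in at_right x. g y \<le> prob {\<omega> \<in> space M. x \<le> Y \<omega> \<and> E \<omega>}"
    using S'[of "{x<..}"] right
  proof eventually_elim
    case (elim y)
    obtain Z where "\<And>n. Z n \<in> borel_measurable M" "\<And>\<omega>. \<omega> \<in> space M \<Longrightarrow> (\<lambda>n. Z n \<omega>) \<longlonglongrightarrow> Y \<omega>"
      "(\<lambda>n. prob {\<omega> \<in> space M. y \<le> Z n \<omega> \<and> E \<omega>}) \<longlonglongrightarrow> g y"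
      using approx[OF elim(1)] by blast
    then show ?case using tail_limit_bounds(2)[OF Y _ E _ elim(2)] by blast
  qed
  show "g x \<le> prob {\<omega> \<in> space M. x \<le> Y \<omega> \<and> E \<omega>}"
    by (rule tendsto_upperbound[OF _ lb]) (use g in \<open>auto simp: isCont_def intro: filterlim_mono at_le\<close>)
qed

end

context prob_space
begin

text \<open>The tail is known inside (a, b) only, and X may have mass outside, such as an atom at b.
  The two measures are hence compared on half-open intervals inside (a, b), where differences of
  tails suffice, and then on an exhaustion of (a, b).\<close>

lemma tail_density:
  fixes X :: "'a \<Rightarrow> real" and f g :: "real \<Rightarrow> real"
  assumes [measurable]: "X \<in> borel_measurable M" "Measurable.pred M E"
    and cont: "continuous_on {a..b} f" and nonneg: "\<And>x. x \<in> {a<..<b} \<Longrightarrow> 0 \<le> f x"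
    and deriv: "\<And>x. x \<in> {a<..<b} \<Longrightarrow> (g has_real_derivative - f x) (at x)"
    and tail: "\<And>x. x \<in> {a<..<b} \<Longrightarrow> prob {\<omega> \<in> space M. x \<le> X \<omega> \<and> E \<omega>} = g x"
  shows "set_integrable lborel {a<..<b} f"
    and "\<And>B. B \<in> sets borel \<Longrightarrow> B \<subseteq> {a<..<b} \<Longrightarrow> prob {\<omega> \<in> space M. X \<omega> \<in> B \<and> E \<omega>} = (LINT x:B|lborel. f x)"
proof -
  show si: "set_integrable lborel {a<..<b} f"
    by (rule set_integrable_subset[OF borel_integrable_atLeastAtMost'[OF cont]]) auto
  have fm: "(\<lambda>x. indicator {a<..<b} x * f x) \<in> borel_measurable borel"
    using borel_measurable_integrable[OF si[unfolded set_integrable_def]] by simp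
  note fm [measurable]
  define \<mu> where "\<mu> = density lborel (\<lambda>x. ennreal (indicator {a<..<b} x * f x))"
  define \<nu> where "\<nu> = distr (restrict_space M {\<omega> \<in> space M. E \<omega>}) borel X"
  have sets [simp]: "sets \<mu> = sets borel" "sets \<nu> = sets borel"
    by (simp_all add: \<mu>_def \<nu>_def)
  have \<nu>: "emeasure \<nu> B = ennreal (prob {\<omega> \<in> space M. X \<omega> \<in> B \<and> E \<omega>})" if [measurable]: "B \<in> sets borel" for B
    unfolding \<nu>_def
    by (subst emeasure_distr)
       (auto simp: measurable_restrict_space1 space_restrict_space emeasure_restrict_space emeasure_eq_measure
         intro!: arg_cong[where f = prob])
  \<comment> \<open>Continuity of g makes the strict tail equal to the weak one, so half-open
    intervals have differences of g as probabilities.\<close>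
  have tail': "prob {\<omega> \<in> space M. x < X \<omega> \<and> E \<omega>} = g x" if x: "x \<in> {a<..<b}" for x
  proof (rule antisym)
    have "prob {\<omega> \<in> space M. x < X \<omega> \<and> E \<omega>} \<le> prob {\<omega> \<in> space M. x \<le> X \<omega> \<and> E \<omega>}"
      by (intro finite_measure_mono) auto
    then show "prob {\<omega> \<in> space M. x < X \<omega> \<and> E \<omega>} \<le> g x" using tail[OF x] by simp
    have "\<forall>\<^sub>F y in at_right x. y \<in> {x<..<b}"
      using x by (intro eventually_at_rightI[of x b]) auto
    then have ev: "\<forall>\<^sub>F y in at_right x. g y \<le> prob {\<omega> \<in> space M. x < X \<omega> \<and> E \<omega>}"
    proof eventually_elim
      case (elim y)
      then have "g y = prob {\<omega> \<in> space M. y \<le> X \<omega> \<and> E \<omega>}" using x by (intro tail[symmetric]) auto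
      also have "\<dots> \<le> prob {\<omega> \<in> space M. x < X \<omega> \<and> E \<omega>}"
        using elim by (intro finite_measure_mono) auto
      finally show ?case .
    qed
    have "(g \<longlongrightarrow> g x) (at_right x)"
      using DERIV_isCont[OF deriv[OF x]] by (auto simp: isCont_def intro: filterlim_mono at_le)
    then show "g x \<le> prob {\<omega> \<in> space M. x < X \<omega> \<and> E \<omega>}"
      by (rule tendsto_upperbound[OF _ ev]) simp
  qed
  have Ioc: "emeasure \<mu> {x<..y} = emeasure \<nu> {x<..y}" if "a < x" "x \<le> y" "y < b" for x y
  proof -
    have "emeasure \<mu> {x<..y} = (\<integral>\<^sup>+z. ennreal (indicator {a<..<b} z * f z) * indicator {x<..y} z \<partial>lborel)"
      unfolding \<mu>_def by (rule emeasure_density) auto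
    also have "\<dots> = (\<integral>\<^sup>+z. ennreal (indicator {a<..<b} z * f z) * indicator {x..y} z \<partial>lborel)"
      using AE_lborel_singleton[of x] by (intro nn_integral_cong_AE) (auto simp: indicator_def)
    also have "\<dots> = ennreal ((- g y) - (- g x))"
    proof (rule nn_integral_FTC_Icc[where F = "\<lambda>x. - g x"])
      show "((\<lambda>x. - g x) has_real_derivative indicator {a<..<b} z * f z) (at z)"
        if "z \<in> {x..y}" for z
        using DERIV_minus[OF deriv[of z]] that \<open>a < x\<close> \<open>y < b\<close> by auto
      show "0 \<le> indicator {a<..<b} z * f z" if "z \<in> {x..y}" for z
        using nonneg by (auto simp: indicator_def)
    qed (use that fm in auto)
    also have "(- g y) - (- g x) = prob {\<omega> \<in> space M. X \<omega> \<in> {x<..y} \<and> E \<omega>}"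
    proof -
      have "g x = prob ({\<omega> \<in> space M. X \<omega> \<in> {x<..y} \<and> E \<omega>} \<union> {\<omega> \<in> space M. y < X \<omega> \<and> E \<omega>})"
        using that by (subst tail'[symmetric]) (auto intro!: arg_cong[where f = prob])
      also have "\<dots> = prob {\<omega> \<in> space M. X \<omega> \<in> {x<..y} \<and> E \<omega>} + g y"
        using that by (subst finite_measure_Union) (auto simp: tail'[symmetric])
      finally show ?thesis by simp
    qed
    finally show ?thesis by (simp add: \<nu>)
  qed
  have eq: "emeasure \<mu> B = emeasure \<nu> B" if B: "B \<in> sets borel" "B \<subseteq> {a<..<b}" for B
  proof -
    \<comment> \<open>Restricted to \<open>S n\<close>, both measures are finite and determined by
      their values on half-lines, each of which meets \<open>S n\<close> in a half-open interval or
      not at all.\<close>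
    define S where "S n = {a + 1 / real (Suc n)<..b - 1 / real (Suc n)}" for n
    have Sm [measurable]: "S n \<in> sets borel" for n by (simp add: S_def)
    have S: "emeasure \<mu> (C \<inter> S n) = emeasure \<nu> (C \<inter> S n)" if C: "C \<in> sets borel" for C n
    proof -
      have "density \<mu> (indicator (S n)) = density \<nu> (indicator (S n))"
      proof (rule measure_eqI_lessThan)
        have *: "emeasure (density m (indicator (S n))) {x<..} = emeasure m ({x<..} \<inter> S n)"
          if "sets m = sets borel" for m x
          using that Sm by (subst emeasure_restricted) (simp_all add: Int_commute)
        have **: "emeasure \<mu> ({x<..} \<inter> S n) = emeasure \<nu> ({x<..} \<inter> S n)" for x
        proof (cases "max x (a + 1 / real (Suc n)) \<le> b - 1 / real (Suc n)")
          case True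
          have "{x<..} \<inter> S n = {max x (a + 1 / real (Suc n))<..b - 1 / real (Suc n)}" by (auto simp: S_def)
          moreover have "a < max x (a + 1 / real (Suc n))" by (simp add: less_max_iff_disj)
          moreover have "b - 1 / real (Suc n) < b" by simp
          ultimately show ?thesis using Ioc True by metis
        next
          case False
          then have "{x<..} \<inter> S n = {}" by (auto simp: S_def)
          then show ?thesis by simp
        qed
        show "emeasure (density \<mu> (indicator (S n))) {x<..} = emeasure (density \<nu> (indicator (S n))) {x<..}" for x
          by (simp add: * **)
        show "emeasure (density \<mu> (indicator (S n))) {x<..} < \<infinity>" for x
          by (simp add: * ** \<nu>)
      qed simp_all
      then have "emeasure (density \<mu> (indicator (S n))) C = emeasure (density \<nu> (indicator (S n))) C" by simp
      moreover have "emeasure (density m (indicator (S n))) C = emeasure m (C \<inter> S n)"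
        if "sets m = sets borel" for m
        using that C Sm by (subst emeasure_restricted) (simp_all add: Int_commute)
      ultimately show ?thesis by simp
    qed
    have "incseq S"
    proof (rule incseq_SucI)
      fix n
      have "1 / real (Suc (Suc n)) \<le> 1 / real (Suc n)" by (intro divide_left_mono) auto
      then show "S n \<subseteq> S (Suc n)" by (auto simp: S_def)
    qed
    then have inc: "incseq (\<lambda>n. B \<inter> S n)" by (auto simp: incseq_def)
    have un: "(\<Union>n. B \<inter> S n) = B"
    proof -
      have "\<exists>n. x \<in> S n" if "a < x" "x < b" for x
      proof -
        have "0 < min (x - a) (b - x)" using that by simp
        from reals_Archimedean[OF this] obtain n where "inverse (real (Suc n)) < min (x - a) (b - x)" ..
        then have "1 / real (Suc n) < x - a" "1 / real (Suc n) < b - x" by (simp_all add: inverse_eq_divide)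
        then have "x \<in> S n" unfolding S_def greaterThanAtMost_iff by linarith
        then show ?thesis ..
      qed
      then have "B \<subseteq> (\<Union>n. S n)" using B(2) by (auto simp: subset_iff)
      then show ?thesis by blast
    qed
    have SUP: "(SUP n. emeasure m (B \<inter> S n)) = emeasure m B" if m: "sets m = sets borel" for m
    proof -
      have "B \<inter> S n \<in> sets m" for n unfolding m by (intro sets.Int B Sm)
      then have "range (\<lambda>n. B \<inter> S n) \<subseteq> sets m" by blast
      from SUP_emeasure_incseq[OF this inc] show ?thesis by (simp only: un)
    qed
    show ?thesis
      unfolding SUP[OF sets(1), symmetric] SUP[OF sets(2), symmetric] S[OF B(1)] ..
  qed
  show "prob {\<omega> \<in> space M. X \<omega> \<in> B \<and> E \<omega>} = (LINT x:B|lborel. f x)" if B: "B \<in> sets borel" "B \<subseteq> {a<..<b}" for B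
  proof -
    have nn: "0 \<le> indicator B z * f z" for z
      using B(2) nonneg[of z] by (auto simp: indicator_def)
    have int: "integrable lborel (\<lambda>z. indicator B z * f z)"
      using set_integrable_subset[OF si _ B(2)] B(1) by (simp add: set_integrable_def)
    have "ennreal (prob {\<omega> \<in> space M. X \<omega> \<in> B \<and> E \<omega>}) = emeasure \<mu> B"
      using eq[OF B] \<nu>[OF B(1)] by simp
    also have "\<dots> = (\<integral>\<^sup>+z. ennreal (indicator {a<..<b} z * f z) * indicator B z \<partial>lborel)"
      unfolding \<mu>_def using B by (intro emeasure_density) auto
    also have "\<dots> = (\<integral>\<^sup>+z. ennreal (indicator B z * f z) \<partial>lborel)"
      using B(2) by (intro nn_integral_cong) (auto simp: indicator_def)
    also have "\<dots> = ennreal (\<integral>z. indicator B z * f z \<partial>lborel)"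
      by (rule nn_integral_eq_integral[OF int]) (simp add: nn)
    finally have "prob {\<omega> \<in> space M. X \<omega> \<in> B \<and> E \<omega>} = (\<integral>z. indicator B z * f z \<partial>lborel)"
      by (subst (asm) ennreal_inj) (auto intro!: Bochner_Integration.integral_nonneg nn)
    then show ?thesis by (simp add: set_lebesgue_integral_def)
  qed
qed

end

section \<open>Limit laws for functionals of the walk\<close>

context poisson_process
begin

lemma measurable_flips:
  assumes "0 \<le> h"
  shows "(\<lambda>\<omega>. flips n h (\<lambda>s. N s \<omega>)) \<in> measurable M (count_space UNIV)"
proof (rule measurableI)
  fix A :: "bool list set"
  have "{\<omega> \<in> space M. flips n h (\<lambda>s. N s \<omega>) \<in> A} \<in> events" by (rule flips_events[OF assms])
  then show "(\<lambda>\<omega>. flips n h (\<lambda>s. N s \<omega>)) -` A \<inter> space M \<in> events"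
    by (simp add: vimage_def Int_def conj_commute)
qed simp

text \<open>One argument for three functionals T: the maximum with J = {0, 1}, the endpoint with J =
  {0}, and the endpoint for the downward start with J = {1}. The conjunct \<open>True\<close> brings
  the unrestricted tail into the shape of the two parity cases.\<close>

lemma walk_tail:
  fixes T :: "bool list \<Rightarrow> int" and J :: "nat set" and c t x :: real
  defines "H \<equiv> \<lambda>\<epsilon> x. exp (- (rate * t)) * (\<Sum>k\<in>J. pois_tail k
      (\<epsilon> * (rate * t / 2) - \<epsilon> * (rate / (2 * c)) * x) (\<epsilon> * (rate * t / 2) + \<epsilon> * (rate / (2 * c)) * x))"
  assumes "0 < t" "0 < c" and Y: "Y \<in> borel_measurable M"
    and exact: "\<And>p q P Q. P \<le> Q \<Longrightarrow> flip_sum p q (\<lambda>l. of_bool (int Q - int P + 1 \<le> T l)) (P + Q) = (\<Sum>k\<in>J. bin_tail p q k P Q)"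
    and lim: "\<And>\<omega>. \<omega> \<in> space M \<Longrightarrow> (\<lambda>n. c * (t / real n) * T (flips n (t / real n) (\<lambda>s. N s \<omega>))) \<longlonglongrightarrow> Y \<omega>"
    and x: "x \<in> {0<..<c * t}"
  shows "prob {\<omega> \<in> space M. x \<le> Y \<omega> \<and> even (N t \<omega>)} = (H 1 x + H (- 1) x) / 2"
    and "prob {\<omega> \<in> space M. x \<le> Y \<omega> \<and> odd (N t \<omega>)} = (H 1 x - H (- 1) x) / 2"
    and "prob {\<omega> \<in> space M. x \<le> Y \<omega> \<and> True} = H 1 x"
proof -
  have contH: "continuous_on S (H \<epsilon>)" for \<epsilon> S
    unfolding H_def
    by (intro continuous_intros continuous_at_imp_continuous_on ballI DERIV_isCont[OF DERIV_pois_tail])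
  have [measurable]: "N t \<in> measurable M (count_space UNIV)"
    using \<open>0 < t\<close> by (intro measurable_N) simp
  define approx where "approx R g \<longleftrightarrow> (\<forall>y\<in>{0<..<c * t}. \<exists>Z. (\<forall>n. Z n \<in> borel_measurable M) \<and>
      (\<forall>\<omega>\<in>space M. (\<lambda>n. Z n \<omega>) \<longlonglongrightarrow> Y \<omega>) \<and> (\<lambda>n. prob {\<omega> \<in> space M. y \<le> Z n \<omega> \<and> R (N t \<omega>)}) \<longlonglongrightarrow> g y)"
    for R :: "nat \<Rightarrow> bool" and g
  have approx: "approx even (\<lambda>x. (H 1 x + H (- 1) x) / 2) \<and> approx odd (\<lambda>x. (H 1 x - H (- 1) x) / 2) \<and> approx (\<lambda>_. True) (H 1)"
    unfolding approx_def ball_conj_distrib[symmetric]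
  proof
    fix y assume y: "y \<in> {0<..<c * t}"
    \<comment> \<open>These are the fractions of downward and upward steps of a path ending at y.
      With P and Q close to n u and n v, the level Q - P + 1 scales to y, and y > 0 gives u < 1/2,
      hence P <= Q.\<close>
    define u v where "u = (1 - y / (c * t)) / 2" and "v = (1 + y / (c * t)) / 2"
    have uv: "0 < u" "u < 1 / 2" "u + v = 1" "c * t * (v - u) = y"
      using y \<open>0 < t\<close> \<open>0 < c\<close> by (simp_all add: u_def v_def field_simps)
    define P where "P n = nat \<lfloor>real n * u\<rfloor>" for n
    define Q where "Q n = n - P n" for n
    have P: "real (P n) \<le> real n * u" "real n * u < real (P n) + 1" for n
    proof -
      have "real (P n) = of_int \<lfloor>real n * u\<rfloor>" using uv by (simp add: P_def)
      then show "real (P n) \<le> real n * u" "real n * u < real (P n) + 1" by linarith+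
    qed
    have PQ: "P n + Q n = n" "P n \<le> Q n" for n
    proof -
      have "real n * u \<le> real n * (1 / 2)" using uv by (intro mult_left_mono) auto
      then have "real (2 * P n) \<le> real n" using P(1)[of n] by simp
      then have "2 * P n \<le> n" by (simp only: of_nat_le_iff)
      then show "P n + Q n = n" "P n \<le> Q n" by (auto simp: Q_def)
    qed
    have limP: "(\<lambda>n. real (P n) / real n) \<longlonglongrightarrow> u"
    proof (rule real_tendsto_sandwich)
      show "\<forall>\<^sub>F n in sequentially. u - 1 / real n \<le> real (P n) / real n"
        using eventually_gt_at_top[of 0]
      proof eventually_elim
        case (elim n)
        have "(real n * u - 1) / real n \<le> real (P n) / real n"
          using P(2)[of n] by (intro divide_right_mono) auto
        then show ?case using elim by (simp add: diff_divide_distrib)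
      qed
      show "\<forall>\<^sub>F n in sequentially. real (P n) / real n \<le> u"
        using eventually_gt_at_top[of 0]
      proof eventually_elim
        case (elim n)
        then show ?case using P(1)[of n] by (simp add: field_simps)
      qed
      show "(\<lambda>n. u - 1 / real n) \<longlonglongrightarrow> u" by real_asymp
    qed simp
    have limQ: "(\<lambda>n. real (Q n) / real n) \<longlonglongrightarrow> v"
    proof (rule Lim_transform_eventually)
      show "(\<lambda>n. 1 - real (P n) / real n) \<longlonglongrightarrow> v"
      proof -
        have "v = 1 - u" using uv by simp
        then show ?thesis using tendsto_diff[OF tendsto_const limP, of 1] by simp
      qed
      show "\<forall>\<^sub>F n in sequentially. 1 - real (P n) / real n = real (Q n) / real n"
        using eventually_gt_at_top[of 0]
      proof eventually_elim
        case (elim n)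
        have "real n = real (P n) + real (Q n)" by (metis PQ(1) of_nat_add)
        then show ?case using elim by (simp add: field_simps)
      qed
    qed
    define z where "z n = c * (t / real n) * real_of_int (int (Q n) - int (P n) + 1)" for n
    have limz: "z \<longlonglongrightarrow> y"
    proof -
      have "(\<lambda>n. c * t * (real (Q n) / real n - real (P n) / real n + 1 / real n)) \<longlonglongrightarrow> c * t * (v - u + 0)"
        by (intro tendsto_intros limP limQ lim_1_over_n)
      moreover have "c * t * (real (Q n) / real n - real (P n) / real n + 1 / real n) = z n" for n
        by (simp add: z_def diff_divide_distrib add_divide_distrib[symmetric] ring_distribs)
      ultimately show ?thesis using uv by simp
    qed
    \<comment> \<open>The level must be moved to a lattice point \<open>z n\<close> of the right parity; shifting the walk by
      \<open>y - z n\<close> instead keeps the level \<open>y\<close> fixed.\<close>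
    define Z where "Z n \<omega> = c * (t / real n) * T (flips n (t / real n) (\<lambda>s. N s \<omega>)) + (y - z n)" for n \<omega>
    have Zm: "Z n \<in> borel_measurable M" for n
    proof -
      have "(\<lambda>l. c * (t / real n) * real_of_int (T l) + (y - z n)) \<in> measurable (count_space UNIV) borel" by simp
      from measurable_compose[OF measurable_flips this] \<open>0 < t\<close> show ?thesis unfolding Z_def by simp
    qed
    have Zlim: "(\<lambda>n. Z n \<omega>) \<longlonglongrightarrow> Y \<omega>" if "\<omega> \<in> space M" for \<omega>
      using tendsto_add[OF lim[OF that] tendsto_diff[OF tendsto_const[of y] limz]] by (simp add: Z_def)
    define p q where "p n = (1 - exp (- 2 * (rate * t / real n))) / 2" and "q n = (1 + exp (- 2 * (rate * t / real n))) / 2" for n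
    \<comment> \<open>R may depend on the parity alone, because the number of flips on the grid and
      N t agree only modulo 2.\<close>
    have step: "prob {\<omega> \<in> space M. y \<le> Z n \<omega> \<and> R (N t \<omega>)} = flip_sum (p n) (q n) (\<lambda>l. of_bool (int (Q n) - int (P n) + 1 \<le> T l \<and> R (count_list l True))) n"
      if "0 < n" and R: "\<And>a b. even a = even b \<Longrightarrow> R a = R b" for R n
    proof -
      have "y \<le> Z n \<omega> \<longleftrightarrow> int (Q n) - int (P n) + 1 \<le> T (flips n (t / real n) (\<lambda>s. N s \<omega>))" for \<omega>
      proof -
        have "y \<le> Z n \<omega> \<longleftrightarrow> c * (t / real n) * real_of_int (int (Q n) - int (P n) + 1) \<le> c * (t / real n) * T (flips n (t / real n) (\<lambda>s. N s \<omega>))"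
          unfolding Z_def z_def by linarith
        also have "\<dots> \<longleftrightarrow> int (Q n) - int (P n) + 1 \<le> T (flips n (t / real n) (\<lambda>s. N s \<omega>))"
          using \<open>0 < c\<close> \<open>0 < t\<close> \<open>0 < n\<close> by (subst mult_le_cancel_left_pos) (simp_all only: of_int_le_iff, simp)
        finally show ?thesis .
      qed
      moreover have "R (N t \<omega>) \<longleftrightarrow> R (count_list (flips n (t / real n) (\<lambda>s. N s \<omega>)) True)" if "\<omega> \<in> space M" for \<omega>
      proof (rule R)
        have "even (count_list (take n (flips n (t / real n) (\<lambda>s. N s \<omega>))) True) \<longleftrightarrow> even (N (real n * (t / real n)) \<omega>)"
          using \<open>0 < t\<close> that by (intro even_count_flips N_mono N_zero) auto
        then show "even (N t \<omega>) = even (count_list (flips n (t / real n) (\<lambda>s. N s \<omega>)) True)"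
          using \<open>0 < n\<close> by simp
      qed
      ultimately have "{\<omega> \<in> space M. y \<le> Z n \<omega> \<and> R (N t \<omega>)} = {\<omega> \<in> space M.
          (\<lambda>l. int (Q n) - int (P n) + 1 \<le> T l \<and> R (count_list l True)) (flips n (t / real n) (\<lambda>s. N s \<omega>))}"
        by auto
      then show ?thesis
        using prob_flips[of "t / real n" "\<lambda>l. int (Q n) - int (P n) + 1 \<le> T l \<and> R (count_list l True)" n] \<open>0 < t\<close> \<open>0 < n\<close>
        by (simp add: p_def q_def)
    qed
    have exact': "flip_sum p q (\<lambda>l. of_bool (int (Q n) - int (P n) + 1 \<le> T l)) n = (\<Sum>k\<in>J. bin_tail p q k (P n) (Q n))" for p q n
      using exact[OF PQ(2)[of n]] by (simp only: PQ(1))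
    have lim_eps: "(\<lambda>n. \<Sum>k\<in>J. bin_tail (\<epsilon> * p n) (q n) k (P n) (Q n)) \<longlonglongrightarrow> H \<epsilon> y" for \<epsilon>
    proof -
      have "0 < rate * t" using rate_pos \<open>0 < t\<close> by simp
      then have "(\<lambda>n. \<Sum>k\<in>J. bin_tail (\<epsilon> * p n) (q n) k (P n) (Q n)) \<longlonglongrightarrow>
         (\<Sum>k\<in>J. exp (- (rate * t)) * pois_tail k (\<epsilon> * (rate * t) * u) (\<epsilon> * (rate * t) * v))"
        unfolding p_def q_def by (intro tendsto_sum bin_tail_tendsto PQ limP limQ)
      moreover have "\<epsilon> * (rate * t) * u = \<epsilon> * (rate * t / 2) - \<epsilon> * (rate / (2 * c)) * y"
         "\<epsilon> * (rate * t) * v = \<epsilon> * (rate * t / 2) + \<epsilon> * (rate / (2 * c)) * y"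
        using \<open>0 < c\<close> \<open>0 < t\<close> by (simp_all add: u_def v_def field_simps)
      ultimately show ?thesis by (simp only: H_def sum_distrib_left)
    qed
    have lim1: "(\<lambda>n. \<Sum>k\<in>J. bin_tail (p n) (q n) k (P n) (Q n)) \<longlonglongrightarrow> H 1 y"
      using lim_eps[of 1] by simp
    have lim2: "(\<lambda>n. \<Sum>k\<in>J. bin_tail (- p n) (q n) k (P n) (Q n)) \<longlonglongrightarrow> H (-1) y"
      using lim_eps[of "-1"] by simp
    have "(\<lambda>n. prob {\<omega> \<in> space M. y \<le> Z n \<omega> \<and> even (N t \<omega>)}) \<longlonglongrightarrow> (H 1 y + H (- 1) y) / 2"
    proof (rule Lim_transform_eventually[OF tendsto_divide[OF tendsto_add[OF lim1 lim2] tendsto_const]])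
      show "\<forall>\<^sub>F n in sequentially. ((\<Sum>k\<in>J. bin_tail (p n) (q n) k (P n) (Q n)) + (\<Sum>k\<in>J. bin_tail (- p n) (q n) k (P n) (Q n))) / 2
         = prob {\<omega> \<in> space M. y \<le> Z n \<omega> \<and> even (N t \<omega>)}"
        using eventually_gt_at_top[of 0] by eventually_elim (simp add: step[of _ even] flip_sum_even exact')
    qed simp
    moreover have "(\<lambda>n. prob {\<omega> \<in> space M. y \<le> Z n \<omega> \<and> odd (N t \<omega>)}) \<longlonglongrightarrow> (H 1 y - H (- 1) y) / 2"
    proof (rule Lim_transform_eventually[OF tendsto_divide[OF tendsto_diff[OF lim1 lim2] tendsto_const]])
      show "\<forall>\<^sub>F n in sequentially. ((\<Sum>k\<in>J. bin_tail (p n) (q n) k (P n) (Q n)) - (\<Sum>k\<in>J. bin_tail (- p n) (q n) k (P n) (Q n))) / 2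
         = prob {\<omega> \<in> space M. y \<le> Z n \<omega> \<and> odd (N t \<omega>)}"
        using eventually_gt_at_top[of 0] by eventually_elim (simp add: step[of _ odd] flip_sum_odd exact')
    qed simp
    moreover have "(\<lambda>n. prob {\<omega> \<in> space M. y \<le> Z n \<omega> \<and> True}) \<longlonglongrightarrow> H 1 y"
    proof (rule Lim_transform_eventually[OF lim1])
      show "\<forall>\<^sub>F n in sequentially. (\<Sum>k\<in>J. bin_tail (p n) (q n) k (P n) (Q n)) = prob {\<omega> \<in> space M. y \<le> Z n \<omega> \<and> True}"
        using eventually_gt_at_top[of 0]
      proof eventually_elim
        case (elim n)
        show ?case using step[OF elim, of "\<lambda>_. True"] exact'[of "p n" "q n" n] by simp
      qed
    qed
    ultimately show "(\<exists>Z. (\<forall>n. Z n \<in> borel_measurable M) \<and> (\<forall>\<omega>\<in>space M. (\<lambda>n. Z n \<omega>) \<longlonglongrightarrow> Y \<omega>) \<and>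
          (\<lambda>n. prob {\<omega> \<in> space M. y \<le> Z n \<omega> \<and> even (N t \<omega>)}) \<longlonglongrightarrow> (H 1 y + H (- 1) y) / 2) \<and>
       (\<exists>Z. (\<forall>n. Z n \<in> borel_measurable M) \<and> (\<forall>\<omega>\<in>space M. (\<lambda>n. Z n \<omega>) \<longlonglongrightarrow> Y \<omega>) \<and>
          (\<lambda>n. prob {\<omega> \<in> space M. y \<le> Z n \<omega> \<and> odd (N t \<omega>)}) \<longlonglongrightarrow> (H 1 y - H (- 1) y) / 2) \<and>
       (\<exists>Z. (\<forall>n. Z n \<in> borel_measurable M) \<and> (\<forall>\<omega>\<in>space M. (\<lambda>n. Z n \<omega>) \<longlonglongrightarrow> Y \<omega>) \<and>
          (\<lambda>n. prob {\<omega> \<in> space M. y \<le> Z n \<omega> \<and> True}) \<longlonglongrightarrow> H 1 y)"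
      using Zm Zlim by (intro conjI exI[of _ Z]) auto
  qed
  have S: "open {0<..<c * t}" by simp
  show "prob {\<omega> \<in> space M. x \<le> Y \<omega> \<and> even (N t \<omega>)} = (H 1 x + H (- 1) x) / 2"
    using approx unfolding approx_def by (intro tail_limit[OF Y _ S _ x] continuous_intros contH) auto
  show "prob {\<omega> \<in> space M. x \<le> Y \<omega> \<and> odd (N t \<omega>)} = (H 1 x - H (- 1) x) / 2"
    using approx unfolding approx_def by (intro tail_limit[OF Y _ S _ x] continuous_intros contH) auto
  show "prob {\<omega> \<in> space M. x \<le> Y \<omega> \<and> True} = H 1 x"
    using approx unfolding approx_def by (intro tail_limit[OF Y _ S _ x] continuous_intros contH) auto
qed

end

section \<open>The telegraph process with deterministic initial velocity\<close>

context poisson_process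
begin

lemma telegraph_const_measurable: "0 \<le> s \<Longrightarrow> telegraph (\<lambda>_. v) N s \<in> borel_measurable M"
  unfolding telegraph_eq[abs_def]
  by (intro borel_measurable_times borel_measurable_const borel_measurable_dir_int measurable_N N_mono N_zero)

lemma running_max_const_measurable:
  "0 < s \<Longrightarrow> running_max (telegraph (\<lambda>_. v) N) s \<in> borel_measurable M"
  by (intro borel_measurable_running_max borel_measurable_const measurable_N N_mono N_zero)

end

locale poisson_telegraph = poisson_process +
  fixes c t :: real
  assumes c_pos: "0 < c" and t_pos: "0 < t"
begin

text \<open>The two Poisson means belonging to the level x are \<alpha> - \<gamma> x and \<alpha> +
  \<gamma> x; \<open>w x\<close> is their product.\<close>

definition \<alpha> :: real where "\<alpha> = rate * t / 2"
definition \<gamma> :: real where "\<gamma> = rate / (2 * c)"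
definition w :: "real \<Rightarrow> real" where "w x = \<alpha>\<^sup>2 - (\<gamma> * x)\<^sup>2"

text \<open>\<open>\<epsilon> = - 1\<close> is the limit of the walk with weight \<open>- p\<close>, needed to separate the parities of \<open>N t\<close>.\<close>

definition tail :: "nat \<Rightarrow> real \<Rightarrow> real \<Rightarrow> real" where
  "tail k \<epsilon> x = exp (- (rate * t)) * pois_tail k (\<epsilon> * \<alpha> - \<epsilon> * \<gamma> * x) (\<epsilon> * \<alpha> + \<epsilon> * \<gamma> * x)"

lemma \<alpha>_pos: "0 < \<alpha>" and \<gamma>_pos: "0 < \<gamma>"
  using rate_pos c_pos t_pos by (simp_all add: \<alpha>_def \<gamma>_def)

lemma \<gamma>_bound: "x \<in> {0<..<c * t} \<Longrightarrow> 0 < \<gamma> * x \<and> \<gamma> * x < \<alpha>"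
  using rate_pos c_pos by (auto simp: \<alpha>_def \<gamma>_def field_simps)

lemma w_pos: "x \<in> {0<..<c * t} \<Longrightarrow> 0 < w x"
  using \<gamma>_bound[of x] \<alpha>_pos by (simp add: w_def power_strict_mono)

lemma w_mult: "\<epsilon>\<^sup>2 = 1 \<Longrightarrow> (\<epsilon> * \<alpha> - \<epsilon> * \<gamma> * x) * (\<epsilon> * \<alpha> + \<epsilon> * \<gamma> * x) = w x"
proof -
  assume e: "\<epsilon>\<^sup>2 = 1"
  have "(\<epsilon> * \<alpha> - \<epsilon> * \<gamma> * x) * (\<epsilon> * \<alpha> + \<epsilon> * \<gamma> * x) = \<epsilon>\<^sup>2 * w x"
    by (simp add: w_def algebra_simps power2_eq_square)
  then show ?thesis using e by simp
qed

text \<open>The sign \<epsilon> cancels in the product of the means, hence in the argument of both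
  series. What remains is odd in \<epsilon> at \<open>bess0\<close> and even at
  \<open>bess1\<close>: averaging over \<epsilon> isolates \<open>bess1\<close> for even N t, and
  the half difference isolates \<open>bess0\<close> for odd N t.\<close>

lemma DERIV_tail_0:
  assumes "\<epsilon>\<^sup>2 = 1"
  shows "(tail 0 \<epsilon> has_real_derivative
     - exp (- (rate * t)) * \<gamma> * (\<epsilon> * bess0 (w x) + (\<alpha> + \<gamma> * x) * bess1 (w x))) (at x)"
proof -
  have e: "\<epsilon> * (\<epsilon> * z) = z" for z
    using assms by (simp add: power2_eq_square mult.assoc[symmetric])
  show ?thesis
    unfolding tail_def[abs_def]
    by (rule DERIV_cong[OF DERIV_cmult[OF DERIV_pois_tail_0[of "\<epsilon> * \<alpha>" "\<epsilon> * \<gamma>" x, unfolded w_mult[OF assms]]]])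
       (simp add: algebra_simps e)
qed

lemma DERIV_tail_1:
  assumes "\<epsilon>\<^sup>2 = 1"
  shows "(tail 1 \<epsilon> has_real_derivative
     - exp (- (rate * t)) * \<gamma> * (\<epsilon> * bess0 (w x) + (\<alpha> - \<gamma> * x) * bess1 (w x))) (at x)"
proof -
  have e: "\<epsilon> * (\<epsilon> * z) = z" for z
    using assms by (simp add: power2_eq_square mult.assoc[symmetric])
  show ?thesis
    unfolding tail_def[abs_def]
    by (rule DERIV_cong[OF DERIV_cmult[OF DERIV_pois_tail_1[of "\<epsilon> * \<alpha>" "\<epsilon> * \<gamma>" x, unfolded w_mult[OF assms]]]])
       (simp add: algebra_simps e)
qed

lemma continuous_on_bess_w: "continuous_on S (\<lambda>x. bess0 (w x))" "continuous_on S (\<lambda>x. bess1 (w x))"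
proof -
  have w: "isCont w x" for x unfolding w_def[abs_def] by (intro continuous_intros)
  show "continuous_on S (\<lambda>x. bess0 (w x))" "continuous_on S (\<lambda>x. bess1 (w x))"
    by (auto intro!: continuous_at_imp_continuous_on isCont_o2[OF w] isCont_bess1 DERIV_isCont[OF DERIV_bess0])
qed

lemma flip_sum_final_length:
  "flip_sum p q (\<lambda>l. of_bool (int Q - int P + 1 \<le> psum l (Suc (length l)))) (P + Q) = bin_tail p q 0 P Q"
  "flip_sum p q (\<lambda>l. of_bool (int Q - int P + 1 \<le> - psum l (Suc (length l)))) (P + Q) = bin_tail p q 1 P Q"
proof -
  have cong: "flip_sum p q (\<lambda>l. of_bool (E l (Suc (length l)))) (P + Q) = flip_sum p q (\<lambda>l. of_bool (E l (Suc (P + Q)))) (P + Q)"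
    for E :: "bool list \<Rightarrow> nat \<Rightarrow> bool"
    by (rule flip_sum_cong) simp
  show "flip_sum p q (\<lambda>l. of_bool (int Q - int P + 1 \<le> psum l (Suc (length l)))) (P + Q) = bin_tail p q 0 P Q"
    "flip_sum p q (\<lambda>l. of_bool (int Q - int P + 1 \<le> - psum l (Suc (length l)))) (P + Q) = bin_tail p q 1 P Q"
    using flip_sum_final[of p q Q P] cong[of "\<lambda>l k. int Q - int P + 1 \<le> psum l k"]
      cong[of "\<lambda>l k. int Q - int P + 1 \<le> - psum l k"] by simp_all
qed

lemma flip_sum_max_length:
  assumes "P \<le> Q"
  shows "flip_sum p q (\<lambda>l. of_bool (int Q - int P + 1 \<le> Max (psum l ` {..Suc (length l)}))) (P + Q)
    = (\<Sum>k\<in>{0, 1}. bin_tail p q k P Q)"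
proof -
  have "int Q - int P + 1 \<le> Max (psum l ` {..Suc n}) \<longleftrightarrow> (\<exists>k\<le>Suc n. int Q - int P + 1 \<le> psum l k)" for l n
    by (subst Max_ge_iff) (auto simp del: atMost_Suc)
  then have "flip_sum p q (\<lambda>l. of_bool (int Q - int P + 1 \<le> Max (psum l ` {..Suc (length l)}))) (P + Q)
     = flip_sum p q (\<lambda>l. of_bool (\<exists>k\<le>Suc (P + Q). int Q - int P + 1 \<le> psum l k)) (P + Q)"
    by (intro flip_sum_cong) simp
  then show ?thesis using flip_sum_max[OF assms] by simp
qed

lemma tail_max:
  assumes x: "x \<in> {0<..<c * t}"
  defines "Y \<equiv> running_max (telegraph (\<lambda>_. c) N) t"
  shows "prob {\<omega> \<in> space M. x \<le> Y \<omega> \<and> even (N t \<omega>)} = (tail 0 1 x + tail 1 1 x + (tail 0 (- 1) x + tail 1 (- 1) x)) / 2"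
    and "prob {\<omega> \<in> space M. x \<le> Y \<omega> \<and> odd (N t \<omega>)} = (tail 0 1 x + tail 1 1 x - (tail 0 (- 1) x + tail 1 (- 1) x)) / 2"
    and "prob {\<omega> \<in> space M. x \<le> Y \<omega> \<and> True} = tail 0 1 x + tail 1 1 x"
proof -
  have Y: "Y \<in> borel_measurable M" unfolding Y_def by (rule running_max_const_measurable[OF t_pos])
  have lim: "(\<lambda>n. c * (t / real n) * (\<lambda>l. Max (psum l ` {..Suc (length l)})) (flips n (t / real n) (\<lambda>s. N s \<omega>))) \<longlonglongrightarrow> Y \<omega>"
    if "\<omega> \<in> space M" for \<omega>
    using running_max_limit[OF N_mono N_zero t_pos, of \<omega> c] that c_pos by (simp add: Y_def running_max_def telegraph_eq del: atMost_Suc)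
  note * = walk_tail[OF t_pos c_pos Y flip_sum_max_length lim x]
  show "prob {\<omega> \<in> space M. x \<le> Y \<omega> \<and> even (N t \<omega>)} = (tail 0 1 x + tail 1 1 x + (tail 0 (- 1) x + tail 1 (- 1) x)) / 2"
    using *(1) by (simp add: tail_def \<alpha>_def \<gamma>_def distrib_left)
  show "prob {\<omega> \<in> space M. x \<le> Y \<omega> \<and> odd (N t \<omega>)} = (tail 0 1 x + tail 1 1 x - (tail 0 (- 1) x + tail 1 (- 1) x)) / 2"
    using *(2) by (simp add: tail_def \<alpha>_def \<gamma>_def distrib_left)
  show "prob {\<omega> \<in> space M. x \<le> Y \<omega> \<and> True} = tail 0 1 x + tail 1 1 x"
    using *(3) by (simp add: tail_def \<alpha>_def \<gamma>_def distrib_left)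
qed

lemma tail_final:
  assumes x: "x \<in> {0<..<c * t}"
  shows "prob {\<omega> \<in> space M. x \<le> telegraph (\<lambda>_. c) N t \<omega> \<and> True} = tail 0 1 x"
    and "prob {\<omega> \<in> space M. x \<le> telegraph (\<lambda>_. - c) N t \<omega> \<and> True} = tail 1 1 x"
proof -
  have Y: "telegraph (\<lambda>_. v) N t \<in> borel_measurable M" for v
    using t_pos by (intro telegraph_const_measurable) simp
  have lim: "(\<lambda>n. c * (t / real n) * (psum (flips n (t / real n) (\<lambda>s. N s \<omega>)) (Suc (length (flips n (t / real n) (\<lambda>s. N s \<omega>)))))) \<longlonglongrightarrow> telegraph (\<lambda>_. c) N t \<omega>"
    if "\<omega> \<in> space M" for \<omega>
    using tendsto_mult[OF tendsto_const dir_int_limit[OF N_mono N_zero], of \<omega> t c] that t_pos by (simp add: telegraph_eq mult.assoc)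
  have lim': "(\<lambda>n. c * (t / real n) * real_of_int (- psum (flips n (t / real n) (\<lambda>s. N s \<omega>)) (Suc (length (flips n (t / real n) (\<lambda>s. N s \<omega>)))))) \<longlonglongrightarrow> telegraph (\<lambda>_. - c) N t \<omega>"
    if "\<omega> \<in> space M" for \<omega>
    using tendsto_minus[OF lim[OF that]] by (simp add: telegraph_eq)
  show "prob {\<omega> \<in> space M. x \<le> telegraph (\<lambda>_. c) N t \<omega> \<and> True} = tail 0 1 x"
    using walk_tail(3)[OF t_pos c_pos Y, of "\<lambda>l. psum l (Suc (length l))" "{0}" c x] lim x
    by (simp add: flip_sum_final_length tail_def \<alpha>_def \<gamma>_def)
  show "prob {\<omega> \<in> space M. x \<le> telegraph (\<lambda>_. - c) N t \<omega> \<and> True} = tail 1 1 x"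
    using walk_tail(3)[OF t_pos c_pos Y, of "\<lambda>l. - psum l (Suc (length l))" "{1}" "- c" x] lim' x flip_sum_final_length(2)
    by (simp add: tail_def \<alpha>_def \<gamma>_def)
qed

section \<open>Densities of the maximum and of the final position\<close>

definition dens_even :: "real \<Rightarrow> real" where "dens_even x = exp (- (rate * t)) * 2 * \<alpha> * \<gamma> * bess1 (w x)"
definition dens_odd :: "real \<Rightarrow> real" where "dens_odd x = exp (- (rate * t)) * 2 * \<gamma> * bess0 (w x)"

lemma dens_nonneg: "x \<in> {0<..<c * t} \<Longrightarrow> 0 \<le> dens_even x" "x \<in> {0<..<c * t} \<Longrightarrow> 0 \<le> dens_odd x"
  using w_pos[of x] \<alpha>_pos \<gamma>_pos by (simp_all add: dens_even_def dens_odd_def bess0_nonneg bess1_nonneg)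

lemma density_max_even:
  "set_integrable lborel {0<..<c * t} dens_even"
  "B \<in> sets borel \<Longrightarrow> B \<subseteq> {0<..<c * t} \<Longrightarrow>
     prob {\<omega> \<in> space M. running_max (telegraph (\<lambda>_. c) N) t \<omega> \<in> B \<and> even (N t \<omega>)} = (LINT x:B|lborel. dens_even x)"
proof -
  have E: "Measurable.pred M (\<lambda>\<omega>. even (N t \<omega>))"
    using measurable_N[OF less_imp_le[OF t_pos]] by measurable
  have cont: "continuous_on {0..c * t} dens_even"
    unfolding dens_even_def[abs_def] by (intro continuous_intros continuous_on_bess_w)
  have D: "((\<lambda>x. (tail 0 1 x + tail 1 1 x + (tail 0 (- 1) x + tail 1 (- 1) x)) / 2) has_real_derivative - dens_even x) (at x)" for x
    by (rule DERIV_cong[OF DERIV_cdivide[OF DERIV_add[OF DERIV_add[OF DERIV_tail_0 DERIV_tail_1] DERIV_add[OF DERIV_tail_0 DERIV_tail_1]]]])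
       (simp_all add: dens_even_def algebra_simps)
  note * = tail_density[OF running_max_const_measurable[OF t_pos] E cont dens_nonneg(1) D tail_max(1)]
  show "set_integrable lborel {0<..<c * t} dens_even" by (rule *(1))
  show "B \<in> sets borel \<Longrightarrow> B \<subseteq> {0<..<c * t} \<Longrightarrow>
     prob {\<omega> \<in> space M. running_max (telegraph (\<lambda>_. c) N) t \<omega> \<in> B \<and> even (N t \<omega>)} = (LINT x:B|lborel. dens_even x)"
    by (rule *(2))
qed

lemma density_max_odd:
  "set_integrable lborel {0<..<c * t} dens_odd"
  "B \<in> sets borel \<Longrightarrow> B \<subseteq> {0<..<c * t} \<Longrightarrow>
     prob {\<omega> \<in> space M. running_max (telegraph (\<lambda>_. c) N) t \<omega> \<in> B \<and> odd (N t \<omega>)} = (LINT x:B|lborel. dens_odd x)"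
proof -
  have E: "Measurable.pred M (\<lambda>\<omega>. odd (N t \<omega>))"
    using measurable_N[OF less_imp_le[OF t_pos]] by measurable
  have cont: "continuous_on {0..c * t} dens_odd"
    unfolding dens_odd_def[abs_def] by (intro continuous_intros continuous_on_bess_w)
  have D: "((\<lambda>x. (tail 0 1 x + tail 1 1 x - (tail 0 (- 1) x + tail 1 (- 1) x)) / 2) has_real_derivative - dens_odd x) (at x)" for x
    by (rule DERIV_cong[OF DERIV_cdivide[OF DERIV_diff[OF DERIV_add[OF DERIV_tail_0 DERIV_tail_1] DERIV_add[OF DERIV_tail_0 DERIV_tail_1]]]])
       (simp_all add: dens_odd_def algebra_simps)
  note * = tail_density[OF running_max_const_measurable[OF t_pos] E cont dens_nonneg(2) D tail_max(2)]
  show "set_integrable lborel {0<..<c * t} dens_odd" by (rule *(1))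
  show "B \<in> sets borel \<Longrightarrow> B \<subseteq> {0<..<c * t} \<Longrightarrow>
     prob {\<omega> \<in> space M. running_max (telegraph (\<lambda>_. c) N) t \<omega> \<in> B \<and> odd (N t \<omega>)} = (LINT x:B|lborel. dens_odd x)"
    by (rule *(2))
qed

lemma density_max:
  "set_integrable lborel {0<..<c * t} (\<lambda>x. dens_even x + dens_odd x)"
  "B \<in> sets borel \<Longrightarrow> B \<subseteq> {0<..<c * t} \<Longrightarrow>
     prob {\<omega> \<in> space M. running_max (telegraph (\<lambda>_. c) N) t \<omega> \<in> B \<and> True} = (LINT x:B|lborel. dens_even x + dens_odd x)"
proof -
  have E: "Measurable.pred M (\<lambda>\<omega>. True)" by simp
  have cont: "continuous_on {0..c * t} (\<lambda>x. dens_even x + dens_odd x)"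
    unfolding dens_odd_def dens_even_def by (intro continuous_intros continuous_on_bess_w)
  have D: "((\<lambda>x. tail 0 1 x + tail 1 1 x) has_real_derivative - (dens_even x + dens_odd x)) (at x)" for x
    by (rule DERIV_cong[OF DERIV_add[OF DERIV_tail_0 DERIV_tail_1]])
       (simp_all add: dens_odd_def dens_even_def algebra_simps)
  note * = tail_density[OF running_max_const_measurable[OF t_pos] E cont add_nonneg_nonneg[OF dens_nonneg] D tail_max(3)]
  show "set_integrable lborel {0<..<c * t} (\<lambda>x. dens_even x + dens_odd x)" by (rule *(1))
  show "B \<in> sets borel \<Longrightarrow> B \<subseteq> {0<..<c * t} \<Longrightarrow>
     prob {\<omega> \<in> space M. running_max (telegraph (\<lambda>_. c) N) t \<omega> \<in> B \<and> True} = (LINT x:B|lborel. dens_even x + dens_odd x)"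
    by (rule *(2))
qed

text \<open>The tails of the endpoint for the two velocities are the summands of the tail of the
  maximum. In the sum of the two densities the terms \<gamma> x cancel.\<close>

lemma density_final:
  assumes B: "B \<in> sets borel" "B \<subseteq> {0<..<c * t}"
  shows "prob {\<omega> \<in> space M. telegraph (\<lambda>_. c) N t \<omega> \<in> B} + prob {\<omega> \<in> space M. telegraph (\<lambda>_. - c) N t \<omega> \<in> B}
    = (LINT x:B|lborel. dens_even x + dens_odd x)"
proof -
  define f where "f s x = exp (- (rate * t)) * \<gamma> * (bess0 (w x) + (\<alpha> + s * \<gamma> * x) * bess1 (w x))" for s x
  have E: "Measurable.pred M (\<lambda>\<omega>. True)" by simp
  have cont: "continuous_on {0..c * t} (f s)" for s
    unfolding f_def[abs_def] by (intro continuous_intros continuous_on_bess_w)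
  have nonneg: "0 \<le> f 1 x" "0 \<le> f (- 1) x" if "x \<in> {0<..<c * t}" for x
  proof -
    have "0 \<le> bess0 (w x)" "0 \<le> bess1 (w x)" "0 \<le> \<alpha> + \<gamma> * x" "0 \<le> \<alpha> - \<gamma> * x"
      using w_pos[OF that] \<gamma>_bound[OF that] by (simp_all add: bess0_nonneg bess1_nonneg)
    then show "0 \<le> f 1 x" "0 \<le> f (- 1) x" using \<gamma>_pos by (simp_all add: f_def)
  qed
  have D0: "(tail 0 1 has_real_derivative - f 1 x) (at x)" for x
    by (rule DERIV_cong[OF DERIV_tail_0]) (simp_all add: f_def)
  have D1: "(tail 1 1 has_real_derivative - f (-1) x) (at x)" for x
    by (rule DERIV_cong[OF DERIV_tail_1]) (simp_all add: f_def)
  have m: "telegraph (\<lambda>_. v) N t \<in> borel_measurable M" for v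
    using t_pos by (intro telegraph_const_measurable) simp
  note 1 = tail_density[OF m E cont nonneg(1) D0 tail_final(1)]
  note 2 = tail_density[OF m E cont nonneg(2) D1 tail_final(2)]
  have "prob {\<omega> \<in> space M. telegraph (\<lambda>_. c) N t \<omega> \<in> B} = (LINT x:B|lborel. f 1 x)"
    using 1(2)[OF _ _ B] by simp
  moreover have "prob {\<omega> \<in> space M. telegraph (\<lambda>_. - c) N t \<omega> \<in> B} = (LINT x:B|lborel. f (-1) x)"
    using 2(2)[OF _ _ B] by simp
  moreover have "set_integrable lborel B (f 1)" "set_integrable lborel B (f (- 1))"
    using set_integrable_subset[OF 1(1)] set_integrable_subset[OF 2(1)] B by simp_all
  then have "(LINT x:B|lborel. f 1 x) + (LINT x:B|lborel. f (-1) x) = (LINT x:B|lborel. f 1 x + f (-1) x)"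
    by (rule set_integral_add(2)[symmetric])
  moreover have "f 1 x + f (-1) x = dens_even x + dens_odd x" for x
    by (simp add: f_def dens_even_def dens_odd_def algebra_simps)
  ultimately show ?thesis by simp
qed

lemma dir_int_le: "\<omega> \<in> space M \<Longrightarrow> s \<in> {0..t} \<Longrightarrow> c * dir_int (\<lambda>u. N u \<omega>) s \<le> c * t"
  using abs_dir_int_le[OF N_mono, of \<omega> s] c_pos by auto

text \<open>The atom is bounded above by the tails at levels below c t, and their limit at c t is
  explicit since one Poisson mean vanishes there. It is bounded below by the event of no jump up to
  t, on which the path is a straight line.\<close>

lemma prob_max_eq: "prob {\<omega> \<in> space M. running_max (telegraph (\<lambda>_. c) N) t \<omega> = c * t} = exp (- (rate * t))"
proof (rule antisym)
  let ?Y = "running_max (telegraph (\<lambda>_. c) N) t"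
  have [measurable]: "?Y \<in> borel_measurable M" by (rule running_max_const_measurable[OF t_pos])
  have ev: "\<forall>\<^sub>F x in at_left (c * t). prob {\<omega> \<in> space M. ?Y \<omega> = c * t} \<le> tail 0 1 x + tail 1 1 x"
  proof -
    have "\<forall>\<^sub>F x in at_left (c * t). x \<in> {0<..<c * t}"
      using c_pos t_pos by (intro eventually_at_leftI[of 0]) auto
    then show ?thesis
    proof eventually_elim
      case (elim x)
      then have "prob {\<omega> \<in> space M. ?Y \<omega> = c * t} \<le> prob {\<omega> \<in> space M. x \<le> ?Y \<omega> \<and> True}"
        by (intro finite_measure_mono) auto
      then show ?case using tail_max(3)[OF elim] by simp
    qed
  qed
  have "isCont (\<lambda>x. tail 0 1 x + tail 1 1 x) (c * t)"
    by (intro continuous_intros DERIV_isCont[OF DERIV_tail_0] DERIV_isCont[OF DERIV_tail_1]) auto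
  then have "((\<lambda>x. tail 0 1 x + tail 1 1 x) \<longlongrightarrow> tail 0 1 (c * t) + tail 1 1 (c * t)) (at_left (c * t))"
    by (auto simp: isCont_def intro: filterlim_mono at_le)
  from tendsto_lowerbound[OF this ev]
  have "prob {\<omega> \<in> space M. ?Y \<omega> = c * t} \<le> tail 0 1 (c * t) + tail 1 1 (c * t)" by simp
  also have "\<alpha> - \<gamma> * (c * t) = 0" using c_pos by (simp add: \<alpha>_def \<gamma>_def)
  then have "tail 0 1 (c * t) + tail 1 1 (c * t) = exp (- (rate * t))"
    by (simp add: tail_def pois_tail_zero_left[unfolded One_nat_def])
  finally show "prob {\<omega> \<in> space M. ?Y \<omega> = c * t} \<le> exp (- (rate * t))" .
  have [measurable]: "N t \<in> measurable M (count_space UNIV)" "N 0 \<in> measurable M (count_space UNIV)"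
    using t_pos by (auto intro: measurable_N)
  have "exp (- (rate * t)) = measure_pmf.prob (poisson_pmf (rate * (t - 0))) {0}"
    using rate_pos t_pos by (simp add: measure_pmf_single)
  also have "\<dots> = measure (distr M (count_space UNIV) (\<lambda>\<omega>. N t \<omega> - N 0 \<omega>)) {0}"
    using t_pos by (simp only: N_increment[OF order_refl])
  also have "\<dots> = prob {\<omega> \<in> space M. N t \<omega> = 0}"
    by (subst measure_distr) (auto intro!: arg_cong[where f = prob] simp: N_zero)
  also have "\<dots> \<le> prob {\<omega> \<in> space M. ?Y \<omega> = c * t}"
  proof (rule finite_measure_mono)
    show "{\<omega> \<in> space M. N t \<omega> = 0} \<subseteq> {\<omega> \<in> space M. ?Y \<omega> = c * t}"
    proof safe
      fix \<omega> assume \<omega>: "\<omega> \<in> space M" "N t \<omega> = 0"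
      have "N u \<omega> = 0" if "u \<in> {0..t}" for u
        using mono_onD[OF N_mono[OF \<omega>(1)], of u t] \<omega>(2) that by auto
      then have "integral {0..t} (\<lambda>u. (- 1) ^ N u \<omega> :: real) = integral {0..t} (\<lambda>u. 1)"
        by (intro integral_cong) simp
      then have "dir_int (\<lambda>u. N u \<omega>) t = t"
        using t_pos by (simp add: dir_int_eq[OF N_mono[OF \<omega>(1)]])
      moreover have "(SUP s\<in>{0..t}. c * dir_int (\<lambda>u. N u \<omega>) s) = c * dir_int (\<lambda>u. N u \<omega>) t"
        using t_pos calculation dir_int_le[OF \<omega>(1)] by (intro cSup_eq_maximum imageI) auto
      ultimately show "?Y \<omega> = c * t"
        by (simp add: running_max_def telegraph_eq)
    qed
  qed measurable
  finally show "exp (- (rate * t)) \<le> prob {\<omega> \<in> space M. ?Y \<omega> = c * t}" .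
qed

section \<open>Identification with Bessel functions\<close>

lemma w_eq: "w x = (rate / (2 * c))\<^sup>2 * (c\<^sup>2 * t\<^sup>2 - x\<^sup>2)"
  using c_pos by (simp add: w_def \<alpha>_def \<gamma>_def field_simps power2_eq_square)

lemma sqrt_w_eq: "rate / c * sqrt (c\<^sup>2 * t\<^sup>2 - x\<^sup>2) = 2 * sqrt (w x)"
  using rate_pos c_pos by (simp add: w_eq real_sqrt_mult)

lemma dens_odd_bessel:
  assumes "x \<in> {0<..<c * t}"
  shows "rate * exp (- rate * t) / c * bessel_I 0 (rate / c * sqrt (c\<^sup>2 * t\<^sup>2 - x\<^sup>2)) = dens_odd x"
proof -
  have "bessel_I 0 (rate / c * sqrt (c\<^sup>2 * t\<^sup>2 - x\<^sup>2)) = bess0 (w x)"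
    using w_pos[OF assms] by (simp only: sqrt_w_eq bessel_I_0_eq)
  then show ?thesis using c_pos by (simp add: dens_odd_def \<gamma>_def)
qed

lemma dens_even_bessel:
  assumes "x \<in> {0<..<c * t}"
  shows "rate * t * exp (- rate * t) / sqrt (c\<^sup>2 * t\<^sup>2 - x\<^sup>2) * bessel_I 1 (rate / c * sqrt (c\<^sup>2 * t\<^sup>2 - x\<^sup>2)) = dens_even x"
proof -
  have s: "sqrt (w x) = rate / (2 * c) * sqrt (c\<^sup>2 * t\<^sup>2 - x\<^sup>2)"
  proof -
    have "sqrt (w x) = rate / c * sqrt (c\<^sup>2 * t\<^sup>2 - x\<^sup>2) / 2" by (simp only: sqrt_w_eq)
    then show ?thesis by simp
  qed
  then have "sqrt (c\<^sup>2 * t\<^sup>2 - x\<^sup>2) \<noteq> 0" using w_pos[OF assms] by auto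
  moreover have "bessel_I 1 (rate / c * sqrt (c\<^sup>2 * t\<^sup>2 - x\<^sup>2)) = sqrt (w x) * bess1 (w x)"
    using w_pos[OF assms] by (simp only: sqrt_w_eq bessel_I_1_eq)
  ultimately show ?thesis
    unfolding s using c_pos by (simp add: dens_even_def \<alpha>_def \<gamma>_def field_simps)
qed

lemma DERIV_bessel:
  assumes x: "x \<in> {0<..<c * t}"
  shows "((\<lambda>\<tau>. bessel_I 0 (rate / c * sqrt (c\<^sup>2 * \<tau>\<^sup>2 - x\<^sup>2))) has_real_derivative c * exp (rate * t) * dens_even x) (at t)"
proof -
  have D: "((\<lambda>\<tau>. bess0 ((rate / (2 * c))\<^sup>2 * (c\<^sup>2 * \<tau>\<^sup>2 - x\<^sup>2))) has_real_derivative bess1 (w x) * ((rate / (2 * c))\<^sup>2 * (c\<^sup>2 * (2 * t)))) (at t)"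
    unfolding w_eq by (rule DERIV_chain2[OF DERIV_bess0]) (auto intro!: derivative_eq_intros)
  \<comment> \<open>For \<tau> > x / c the radicand stays nonnegative, so near t the Bessel
    expression coincides with the power series \<open>bess0\<close>, which is differentiable
    everywhere.\<close>
  have ev: "\<forall>\<^sub>F \<tau> in nhds t. bessel_I 0 (rate / c * sqrt (c\<^sup>2 * \<tau>\<^sup>2 - x\<^sup>2)) = bess0 ((rate / (2 * c))\<^sup>2 * (c\<^sup>2 * \<tau>\<^sup>2 - x\<^sup>2))"
  proof (rule eventually_nhds_in_open[THEN eventually_mono])
    show "open {x / c<..}" by simp
    show "t \<in> {x / c<..}" using x c_pos by (simp add: field_simps)
    fix \<tau> assume "\<tau> \<in> {x / c<..}"
    then have "x < c * \<tau>" using c_pos by (simp add: field_simps)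
    then have "x\<^sup>2 \<le> (c * \<tau>)\<^sup>2" using x by (intro power_mono) auto
    then have "0 \<le> (rate / (2 * c))\<^sup>2 * (c\<^sup>2 * \<tau>\<^sup>2 - x\<^sup>2)" by (simp add: power_mult_distrib)
    moreover have "rate / c * sqrt (c\<^sup>2 * \<tau>\<^sup>2 - x\<^sup>2) = 2 * sqrt ((rate / (2 * c))\<^sup>2 * (c\<^sup>2 * \<tau>\<^sup>2 - x\<^sup>2))"
      using rate_pos c_pos by (simp add: real_sqrt_mult)
    ultimately show "bessel_I 0 (rate / c * sqrt (c\<^sup>2 * \<tau>\<^sup>2 - x\<^sup>2)) = bess0 ((rate / (2 * c))\<^sup>2 * (c\<^sup>2 * \<tau>\<^sup>2 - x\<^sup>2))"
      by (simp only: bessel_I_0_eq)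
  qed
  have "c * exp (rate * t) * dens_even x = bess1 (w x) * ((rate / (2 * c))\<^sup>2 * (c\<^sup>2 * (2 * t)))"
    using c_pos by (simp add: dens_even_def \<alpha>_def \<gamma>_def exp_minus field_simps power2_eq_square)
  then show ?thesis using D DERIV_cong_ev[OF refl ev refl] by simp
qed

end

section \<open>Random initial velocity\<close>

context symmetric_telegraph
begin

text \<open>These sets generate the sigma-algebra that is independent of \<open>V0\<close>.
  Functionals of the process with a fixed velocity are measurable for it, while those with the
  random velocity need not be.\<close>

definition N_gen :: "'a set set" where
  "N_gen = {N s -` A \<inter> space M | s A. 0 \<le> s}"

lemma space_sigma_N [simp]: "space (sigma (space M) N_gen) = space M"
  and sets_sigma_N: "sets (sigma (space M) N_gen) = sigma_sets (space M) N_gen"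
  by (auto simp: N_gen_def intro!: space_measure_of sets_measure_of)

lemma measurable_N_sigma:
  assumes "0 \<le> s"
  shows "N s \<in> measurable (sigma (space M) N_gen) (count_space UNIV)"
proof (rule measurableI)
  fix A :: "nat set"
  have "N s -` A \<inter> space M \<in> N_gen" using assms by (auto simp: N_gen_def)
  then show "N s -` A \<inter> space (sigma (space M) N_gen) \<in> sets (sigma (space M) N_gen)"
    by (simp add: sets_sigma_N)
qed simp

lemma prob_V0_indep:
  assumes "{\<omega> \<in> space M. \<Phi> \<omega>} \<in> sets (sigma (space M) N_gen)" "C \<in> sets borel"
  shows "prob {\<omega> \<in> space M. \<Phi> \<omega> \<and> V0 \<omega> \<in> C} = prob {\<omega> \<in> space M. V0 \<omega> \<in> C} * prob {\<omega> \<in> space M. \<Phi> \<omega>}"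
proof -
  have "prob ((V0 -` C \<inter> space M) \<inter> {\<omega> \<in> space M. \<Phi> \<omega>}) = prob (V0 -` C \<inter> space M) * prob {\<omega> \<in> space M. \<Phi> \<omega>}"
  proof (rule indep_setD[OF V0_indep_N[folded N_gen_def]])
    show "V0 -` C \<inter> space M \<in> {V0 -` B \<inter> space M | B. B \<in> sets borel}" using assms(2) by blast
    show "{\<omega> \<in> space M. \<Phi> \<omega>} \<in> sigma_sets (space M) N_gen" using assms(1) by (simp only: sets_sigma_N)
  qed
  moreover have "(V0 -` C \<inter> space M) \<inter> {\<omega> \<in> space M. \<Phi> \<omega>} = {\<omega> \<in> space M. \<Phi> \<omega> \<and> V0 \<omega> \<in> C}"
    "V0 -` C \<inter> space M = {\<omega> \<in> space M. V0 \<omega> \<in> C}" by auto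
  ultimately show ?thesis by simp
qed

lemma max_event:
  assumes "0 < t" "B \<in> sets borel"
  shows "{\<omega> \<in> space M. running_max (telegraph (\<lambda>_. v) N) t \<omega> \<in> B \<and> R (N t \<omega>)} \<in> sets (sigma (space M) N_gen)"
proof -
  let ?F = "sigma (space M) N_gen"
  have [measurable]: "running_max (telegraph (\<lambda>_. v) N) t \<in> borel_measurable ?F" "N t \<in> measurable ?F (count_space UNIV)"
    using assms(1)
    by (auto intro!: borel_measurable_running_max measurable_N_sigma N_mono N_zero)
  have "{\<omega> \<in> space ?F. running_max (telegraph (\<lambda>_. v) N) t \<omega> \<in> B \<and> R (N t \<omega>)} \<in> sets ?F"
    using assms(2) by measurable
  then show ?thesis by simp
qed

lemma telegraph_event:
  assumes "0 < t" "B \<in> sets borel"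
  shows "{\<omega> \<in> space M. telegraph (\<lambda>_. v) N t \<omega> \<in> B} \<in> sets (sigma (space M) N_gen)"
proof -
  let ?F = "sigma (space M) N_gen"
  have [measurable]: "telegraph (\<lambda>_. v) N t \<in> borel_measurable ?F"
    unfolding telegraph_eq[abs_def] using assms(1)
    by (auto intro!: borel_measurable_times borel_measurable_const borel_measurable_dir_int measurable_N_sigma N_mono N_zero)
  have "{\<omega> \<in> space ?F. telegraph (\<lambda>_. v) N t \<omega> \<in> B} \<in> sets ?F"
    using assms(2) by measurable
  then show ?thesis by simp
qed

lemma telegraph_cong: "V0 \<omega> = v \<Longrightarrow> telegraph V0 N s \<omega> = telegraph (\<lambda>_. v) N s \<omega>"
  by (simp add: telegraph_eq)

text \<open>On the event \<open>V0 = c\<close> the process is the one with deterministic velocity c,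
  whose events are independent of \<open>V0\<close>; conditioning then has no further
  effect.\<close>

lemma cond_prob_max:
  assumes "0 < t" "B \<in> sets borel"
  shows "\<P>(\<omega> in M. running_max (telegraph V0 N) t \<omega> \<in> B \<and> R (N t \<omega>) \<bar> V0 \<omega> = c)
    = prob {\<omega> \<in> space M. running_max (telegraph (\<lambda>_. c) N) t \<omega> \<in> B \<and> R (N t \<omega>)}"
proof -
  have "{\<omega> \<in> space M. (running_max (telegraph V0 N) t \<omega> \<in> B \<and> R (N t \<omega>)) \<and> V0 \<omega> = c}
      = {\<omega> \<in> space M. (running_max (telegraph (\<lambda>_. c) N) t \<omega> \<in> B \<and> R (N t \<omega>)) \<and> V0 \<omega> \<in> {c}}"
    by (auto simp: running_max_def telegraph_cong)
  moreover have "prob \<dots> = 1 / 2 * prob {\<omega> \<in> space M. running_max (telegraph (\<lambda>_. c) N) t \<omega> \<in> B \<and> R (N t \<omega>)}"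
    using prob_V0_indep[OF max_event[OF assms, of c R], of "{c}"] by (simp only: singleton_iff V0_pos borel_singleton sets.empty_sets)
  ultimately show ?thesis by (simp only: cond_prob_def V0_pos) simp
qed

text \<open>Almost surely \<open>V0\<close> is c or - c, each with probability 1/2, so the law of
  the endpoint is the mean of the laws for the two fixed velocities.\<close>

lemma prob_telegraph:
  assumes "0 < t" "B \<in> sets borel"
  shows "2 * prob {\<omega> \<in> space M. telegraph V0 N t \<omega> \<in> B}
    = prob {\<omega> \<in> space M. telegraph (\<lambda>_. c) N t \<omega> \<in> B} + prob {\<omega> \<in> space M. telegraph (\<lambda>_. - c) N t \<omega> \<in> B}"
proof -
  note measurable_V0 [measurable]
  have [measurable]: "telegraph V0 N t \<in> borel_measurable M"
    unfolding telegraph_eq[abs_def] using assms(1)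
    by (auto intro!: borel_measurable_times borel_measurable_dir_int measurable_N measurable_V0 N_mono N_zero)
  note assms(2) [measurable]
  have "prob {\<omega> \<in> space M. V0 \<omega> = c \<or> V0 \<omega> = - c} = prob ({\<omega> \<in> space M. V0 \<omega> = c} \<union> {\<omega> \<in> space M. V0 \<omega> = - c})"
    by (rule arg_cong[where f = prob]) auto
  also have "\<dots> = 1"
    using speed_pos by (subst finite_measure_Union) (auto simp: V0_pos V0_neg)
  finally have AE: "AE \<omega> in M. V0 \<omega> = c \<or> V0 \<omega> = - c"
    by (subst (asm) prob_Collect_eq_1) auto
  have eq: "prob {\<omega> \<in> space M. telegraph V0 N t \<omega> \<in> B \<and> V0 \<omega> \<in> {v}} = prob {\<omega> \<in> space M. V0 \<omega> = v} * prob {\<omega> \<in> space M. telegraph (\<lambda>_. v) N t \<omega> \<in> B}" for v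
  proof -
    have "{\<omega> \<in> space M. telegraph V0 N t \<omega> \<in> B \<and> V0 \<omega> \<in> {v}} = {\<omega> \<in> space M. telegraph (\<lambda>_. v) N t \<omega> \<in> B \<and> V0 \<omega> \<in> {v}}"
      by (auto simp: telegraph_cong)
    then show ?thesis using prob_V0_indep[OF telegraph_event[OF assms], of "{v}" v] by simp
  qed
  have "prob {\<omega> \<in> space M. telegraph V0 N t \<omega> \<in> B} = prob ({\<omega> \<in> space M. telegraph V0 N t \<omega> \<in> B \<and> V0 \<omega> \<in> {c}} \<union> {\<omega> \<in> space M. telegraph V0 N t \<omega> \<in> B \<and> V0 \<omega> \<in> {- c}})"
    using AE by (intro finite_measure_eq_AE) auto
  also have "\<dots> = prob {\<omega> \<in> space M. telegraph V0 N t \<omega> \<in> B \<and> V0 \<omega> \<in> {c}} + prob {\<omega> \<in> space M. telegraph V0 N t \<omega> \<in> B \<and> V0 \<omega> \<in> {- c}}"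
    using speed_pos by (intro finite_measure_Union) auto
  finally show ?thesis unfolding eq V0_pos V0_neg by simp
qed

text \<open>f is the density in power series form, which is smooth up to the boundary, and f' is its
  Bessel form; agreement on S is enough to pass from one to the other.\<close>

lemma has_cond_density_max:
  assumes "0 < t"
    and "set_integrable lborel S f" "\<And>x. x \<in> S \<Longrightarrow> 0 \<le> f x" "S \<in> sets borel"
    and dens: "\<And>B. B \<in> sets borel \<Longrightarrow> B \<subseteq> S \<Longrightarrow>
       prob {\<omega> \<in> space M. running_max (telegraph (\<lambda>_. c) N) t \<omega> \<in> B \<and> R (N t \<omega>)} = (LINT x:B|lborel. f x)"
    and cong: "\<And>x. x \<in> S \<Longrightarrow> f' x = f x"
  shows "has_cond_density_on M (running_max (telegraph V0 N) t) (\<lambda>\<omega>. R (N t \<omega>)) (\<lambda>\<omega>. V0 \<omega> = c) S f'"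
  unfolding has_cond_density_on_def
proof (intro conjI ballI impI)
  have [measurable]: "N t \<in> measurable M (count_space UNIV)" using assms(1) by (intro measurable_N) simp
  note measurable_V0 [measurable]
  show "running_max (telegraph V0 N) t \<in> borel_measurable M"
    by (intro borel_measurable_running_max measurable_N N_mono N_zero measurable_V0 assms(1))
  show "Measurable.pred M (\<lambda>\<omega>. R (N t \<omega>))" by measurable
  show "Measurable.pred M (\<lambda>\<omega>. V0 \<omega> = c)" by measurable
  show "set_integrable lborel S f'"
    using assms(2) by (rule set_integrable_cong[THEN iffD1, rotated -1]) (auto simp: cong)
  show "0 \<le> f' x" if "x \<in> S" for x using assms(3) cong that by simp
  show "\<P>(\<omega> in M. running_max (telegraph V0 N) t \<omega> \<in> B \<and> R (N t \<omega>) \<bar> V0 \<omega> = c) = (LINT x:B|lborel. f' x)"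
    if B: "B \<in> sets borel" "B \<subseteq> S" for B
  proof -
    have "(LINT x:B|lborel. f' x) = (LINT x:B|lborel. f x)"
      using B cong by (intro set_lebesgue_integral_cong) auto
    then show ?thesis using cond_prob_max[OF assms(1) B(1)] dens[OF B] by simp
  qed
qed

end

theorem mainTheorem4:
  fixes M :: "'a measure" and N :: "real \<Rightarrow> 'a \<Rightarrow> nat" and V0 :: "'a \<Rightarrow> real"
    and c lam t :: real
  assumes "symmetric_telegraph M lam N c V0"
    and "0 < t"
  shows
    "has_cond_density_on M (running_max (telegraph V0 N) t) (\<lambda>\<omega>. even (N t \<omega>)) (\<lambda>\<omega>. V0 \<omega> = c)
       {0<..<c * t}
       (\<lambda>\<beta>. lam * t * exp (- lam * t) / sqrt (c\<^sup>2 * t\<^sup>2 - \<beta>\<^sup>2)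
              * bessel_I 1 (lam / c * sqrt (c\<^sup>2 * t\<^sup>2 - \<beta>\<^sup>2)))
     \<and> (\<forall>\<beta>\<in>{0<..<c * t}.
          (\<lambda>\<tau>. bessel_I 0 (lam / c * sqrt (c\<^sup>2 * \<tau>\<^sup>2 - \<beta>\<^sup>2))) field_differentiable (at t)
          \<and> lam * t * exp (- lam * t) / sqrt (c\<^sup>2 * t\<^sup>2 - \<beta>\<^sup>2)
              * bessel_I 1 (lam / c * sqrt (c\<^sup>2 * t\<^sup>2 - \<beta>\<^sup>2))
            = exp (- lam * t) / c
              * deriv (\<lambda>\<tau>. bessel_I 0 (lam / c * sqrt (c\<^sup>2 * \<tau>\<^sup>2 - \<beta>\<^sup>2))) t)
     \<and> has_cond_density_on M (running_max (telegraph V0 N) t) (\<lambda>\<omega>. odd (N t \<omega>)) (\<lambda>\<omega>. V0 \<omega> = c)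
       {0<..<c * t}
       (\<lambda>\<beta>. lam * exp (- lam * t) / c * bessel_I 0 (lam / c * sqrt (c\<^sup>2 * t\<^sup>2 - \<beta>\<^sup>2)))
     \<and> has_cond_density_on M (running_max (telegraph V0 N) t) (\<lambda>\<omega>. True) (\<lambda>\<omega>. V0 \<omega> = c)
       {0<..<c * t}
       (\<lambda>\<beta>. exp (- lam * t) / c
              * (lam * bessel_I 0 (lam / c * sqrt (c\<^sup>2 * t\<^sup>2 - \<beta>\<^sup>2))
                 + deriv (\<lambda>\<tau>. bessel_I 0 (lam / c * sqrt (c\<^sup>2 * \<tau>\<^sup>2 - \<beta>\<^sup>2))) t))
     \<and> telegraph V0 N t \<in> borel_measurable M
     \<and> (\<forall>B\<in>sets borel. B \<subseteq> {0<..<c * t} \<longrightarrow>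
          \<P>(\<omega> in M. running_max (telegraph V0 N) t \<omega> \<in> B \<bar> V0 \<omega> = c)
          = 2 * \<P>(\<omega> in M. telegraph V0 N t \<omega> \<in> B))
     \<and> \<P>(\<omega> in M. running_max (telegraph V0 N) t \<omega> = c * t \<bar> V0 \<omega> = c) = exp (- lam * t)"
proof -
  interpret symmetric_telegraph M lam N c V0 by fact
  interpret poisson_telegraph M lam N c t
    using speed_pos assms(2) by unfold_locales
  have deriv: "deriv (\<lambda>\<tau>. bessel_I 0 (lam / c * sqrt (c\<^sup>2 * \<tau>\<^sup>2 - x\<^sup>2))) t = c * exp (lam * t) * dens_even x"
    if "x \<in> {0<..<c * t}" for x
    by (rule DERIV_imp_deriv[OF DERIV_bessel[OF that]])
  have even: "exp (- lam * t) / c * deriv (\<lambda>\<tau>. bessel_I 0 (lam / c * sqrt (c\<^sup>2 * \<tau>\<^sup>2 - x\<^sup>2))) t = dens_even x"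
    if "x \<in> {0<..<c * t}" for x
    unfolding deriv[OF that] using speed_pos by (simp add: exp_minus field_simps)
  have sum: "exp (- lam * t) / c * (lam * bessel_I 0 (lam / c * sqrt (c\<^sup>2 * t\<^sup>2 - x\<^sup>2))
        + deriv (\<lambda>\<tau>. bessel_I 0 (lam / c * sqrt (c\<^sup>2 * \<tau>\<^sup>2 - x\<^sup>2))) t) = dens_even x + dens_odd x"
    if "x \<in> {0<..<c * t}" for x
    unfolding distrib_left even[OF that] dens_odd_bessel[OF that, symmetric] by simp
  note hcd = has_cond_density_max[OF assms(2)]
  have "has_cond_density_on M (running_max (telegraph V0 N) t) (\<lambda>\<omega>. even (N t \<omega>)) (\<lambda>\<omega>. V0 \<omega> = c) {0<..<c * t}
       (\<lambda>\<beta>. lam * t * exp (- lam * t) / sqrt (c\<^sup>2 * t\<^sup>2 - \<beta>\<^sup>2) * bessel_I 1 (lam / c * sqrt (c\<^sup>2 * t\<^sup>2 - \<beta>\<^sup>2)))"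
    by (rule hcd[OF density_max_even(1) dens_nonneg(1) _ density_max_even(2) dens_even_bessel]) simp_all
  moreover have "has_cond_density_on M (running_max (telegraph V0 N) t) (\<lambda>\<omega>. odd (N t \<omega>)) (\<lambda>\<omega>. V0 \<omega> = c) {0<..<c * t}
       (\<lambda>\<beta>. lam * exp (- lam * t) / c * bessel_I 0 (lam / c * sqrt (c\<^sup>2 * t\<^sup>2 - \<beta>\<^sup>2)))"
    by (rule hcd[OF density_max_odd(1) dens_nonneg(2) _ density_max_odd(2) dens_odd_bessel]) simp_all
  moreover have "has_cond_density_on M (running_max (telegraph V0 N) t) (\<lambda>\<omega>. True) (\<lambda>\<omega>. V0 \<omega> = c) {0<..<c * t}
       (\<lambda>\<beta>. exp (- lam * t) / c * (lam * bessel_I 0 (lam / c * sqrt (c\<^sup>2 * t\<^sup>2 - \<beta>\<^sup>2))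
                 + deriv (\<lambda>\<tau>. bessel_I 0 (lam / c * sqrt (c\<^sup>2 * \<tau>\<^sup>2 - \<beta>\<^sup>2))) t))"
    by (rule hcd[OF density_max(1) add_nonneg_nonneg[OF dens_nonneg] _ density_max(2) sum]) simp_all
  \<comment> \<open>Differentiability comes with the identity, since \<open>deriv\<close> has an
    unspecified value where no derivative exists.\<close>
  moreover have "(\<lambda>\<tau>. bessel_I 0 (lam / c * sqrt (c\<^sup>2 * \<tau>\<^sup>2 - x\<^sup>2))) field_differentiable (at t)
      \<and> lam * t * exp (- lam * t) / sqrt (c\<^sup>2 * t\<^sup>2 - x\<^sup>2) * bessel_I 1 (lam / c * sqrt (c\<^sup>2 * t\<^sup>2 - x\<^sup>2))
            = exp (- lam * t) / c * deriv (\<lambda>\<tau>. bessel_I 0 (lam / c * sqrt (c\<^sup>2 * \<tau>\<^sup>2 - x\<^sup>2))) t"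
    if "x \<in> {0<..<c * t}" for x
    using DERIV_bessel[OF that] by (simp only: even[OF that] dens_even_bessel[OF that]) (auto simp: field_differentiable_def)
  moreover have "telegraph V0 N t \<in> borel_measurable M"
    unfolding telegraph_eq[abs_def] using assms(2)
    by (auto intro!: borel_measurable_times borel_measurable_dir_int measurable_N measurable_V0 N_mono N_zero)
  moreover have "\<P>(\<omega> in M. running_max (telegraph V0 N) t \<omega> \<in> B \<bar> V0 \<omega> = c) = 2 * \<P>(\<omega> in M. telegraph V0 N t \<omega> \<in> B)"
    if "B \<in> sets borel" "B \<subseteq> {0<..<c * t}" for B
    using cond_prob_max[OF assms(2) that(1), of "\<lambda>_. True"] prob_telegraph[OF assms(2) that(1)]
      density_max(2)[OF that] density_final[OF that] by simp
  moreover have "\<P>(\<omega> in M. running_max (telegraph V0 N) t \<omega> = c * t \<bar> V0 \<omega> = c) = exp (- lam * t)"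
    using cond_prob_max[OF assms(2), of "{c * t}" "\<lambda>_. True"] prob_max_eq by simp
  ultimately show ?thesis by blast
qed

end
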